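(* Let $(\phi^n)_{0\le n\le N}$ be a solution of the stabilized L1 scheme $$\bar\partial_{n+1}^\alpha \phi = \gamma\,\mathcal G\left(\mathcal L\phi^{n+1}+\delta_\phi E_1(\phi^n)+\widetilde{\mathcal L}(\phi^{n+1}-\phi^n)\right),\qquad 0\le n\le N-1,$$ for the time-fractional Allen--Cahn, Cahn--Hilliard, or MBE (without slope selection) model; in the Allen--Cahn case assume $\|\phi^0\|_\infty\le 1$. Let $E^n=E(\phi^n)$. Then $$\bar\partial_n^\alpha E=\sum_{k=1}^n b_{n-k}\,\bar\partial_k E\le 0\qquad\text{for all } 1\le n\le N.$$
   Context: Let $\alpha\in(0,1)$, $\gamma>0$, $\varepsilon>0$, $T>0$, $N\ge1$ an integer, $\Delta t=T/N$, $t_n=n\Delta t$. $\Omega$ is a bounded rectangular box with periodic boundary conditions; $\langle\cdot,\cdot\rangle$ and $\|\cdot\|$ are the $L^2(\Omega)$ inner product and norm, $\|\cdot\|_\infty$ is the sup norm. Each $\phi^n$ is a periodic function on $\Omega$, smooth enough that all expressions make sense. Discrete derivatives. For a sequence $(v^n)_{0\le n\le N}$ (of functions or of real numbers): $\bar\partial_k v=\frac{v^k-v^{k-1}}{\Delta t}$ for $k\ge1$, and the L1 discrete Caputo derivative is $\bar\partial_n^\alpha v=\sum_{j=1}^n b_{n-j}\bar\partial_j v$ for $1\le n\le N$, where $b_j=\frac{\Delta t^{1-\alpha}}{\Gamma(2-\alpha)}\left[(j+1)^{1-\alpha}-j^{1-\alpha}\right]$, $j\ge0$. Models. The energy is split as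 $E(\phi)=\frac12\langle\phi,\mathcal L\phi\rangle+E_1(\phi)$, and $\delta_\phi E_1$ is the variational derivative of $E_1$ in $L^2$. (i) Allen--Cahn (AC): $\mathcal G=-1$, $\mathcal L=-\varepsilon^2\Delta$, $E_1(\phi)=\int_\Omega F(\phi)\,dx$ with $F(\phi)=\frac14(1-\phi^2)^2$, so $\delta_\phi E_1(\phi)=\phi^3-\phi$; $\widetilde{\mathcal L}=S$ with constant $S\ge2$. (ii) Cahn--Hilliard (CH): $\mathcal G=\Delta$ (with inverse $\mathcal G^{-1}$ on mean-zero functions), $\mathcal L=-\varepsilon^2\Delta$, $E_1(\phi)=\int_\Omega F(\phi)\,dx$, $\delta_\phi E_1(\phi)=F'(\phi)$, where $F$ is a truncated ($C^2$) version of the double well $\frac14(1-\phi^2)^2$ such that $\sup_{s\in\mathbb R}|F''(s)|\le L$ for some constant $L>0$; $\widetilde{\mathcal L}=S$ with constant $S\ge L/2$. (iii) MBE without slope selection: $\mathcal G=-1$, $\mathcal L=\varepsilon^2\Delta^2$, $E_1(\phi)=-\frac12\int_\Omega\ln(1+|\nabla\phi|^2)\,dx$, $\delta_\phi E_1(\phi)=\nabla\cdot\frac{\nabla\phi}{1+|\nabla\phi|^2}$; $\widetilde{\mathcal L}=-S\Delta$ with constant $S\ge\frac1{16}$. *)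

theory Defs
  imports "HOL-Analysis.Analysis"
begin

text \<open>The scalar notions below are applied pointwise in space to sequences of functions.\<close>

definition bdiff :: "real \<Rightarrow> (nat \<Rightarrow> real) \<Rightarrow> nat \<Rightarrow> real" where
  "bdiff dt v k = (v k - v (k - 1)) / dt"

text \<open>For \<open>j = 0\<close> the library convention \<open>0 powr (1 - \<alpha>) = 0\<close> gives the intended value.\<close>

definition L1_coeff :: "real \<Rightarrow> real \<Rightarrow> nat \<Rightarrow> real" where
  "L1_coeff \<alpha> dt j =
     dt powr (1 - \<alpha>) / Gamma (2 - \<alpha>) * (real (j + 1) powr (1 - \<alpha>) - real j powr (1 - \<alpha>))"

definition L1_caputo :: "real \<Rightarrow> real \<Rightarrow> (nat \<Rightarrow> real) \<Rightarrow> nat \<Rightarrow> real" where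
  "L1_caputo \<alpha> dt v n = (\<Sum>j = 1..n. L1_coeff \<alpha> dt (n - j) * bdiff dt v j)"

definition partial :: "'a \<Rightarrow> ('a::euclidean_space \<Rightarrow> real) \<Rightarrow> 'a \<Rightarrow> real" where
  "partial i f x = frechet_derivative f (at x) i"

definition grad :: "('a::euclidean_space \<Rightarrow> real) \<Rightarrow> 'a \<Rightarrow> 'a" where
  "grad f x = (\<Sum>i\<in>Basis. partial i f x *\<^sub>R i)"

definition divergence :: "('a::euclidean_space \<Rightarrow> 'a) \<Rightarrow> 'a \<Rightarrow> real" where
  "divergence V x = (\<Sum>i\<in>Basis. frechet_derivative V (at x) i \<bullet> i)"

definition laplacian :: "('a::euclidean_space \<Rightarrow> real) \<Rightarrow> 'a \<Rightarrow> real" where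
  "laplacian f = divergence (grad f)"

primrec Ck :: "nat \<Rightarrow> ('a::euclidean_space \<Rightarrow> real) \<Rightarrow> bool" where
  "Ck 0 f \<longleftrightarrow> continuous_on UNIV f"
| "Ck (Suc k) f \<longleftrightarrow> (\<forall>x. f differentiable (at x)) \<and> (\<forall>i\<in>Basis. Ck k (partial i f))"

text \<open>Functions on the box \<open>cbox a b\<close> with periodic boundary conditions are represented
  by their periodic extensions to the whole space.\<close>

definition box_periodic :: "'a \<Rightarrow> 'a \<Rightarrow> ('a::euclidean_space \<Rightarrow> real) \<Rightarrow> bool" where
  "box_periodic a b f \<longleftrightarrow> (\<forall>i\<in>Basis. \<forall>x. f (x + ((b - a) \<bullet> i) *\<^sub>R i) = f x)"

definition L2_inner :: "'a set \<Rightarrow> ('a::euclidean_space \<Rightarrow> real) \<Rightarrow> ('a \<Rightarrow> real) \<Rightarrow> real" where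
  "L2_inner \<Omega> u v = integral \<Omega> (\<lambda>x. u x * v x)"

text \<open>Only meaningful for functions bounded on \<open>\<Omega>\<close>, such as continuous functions on a compact box.\<close>

definition sup_norm :: "'a set \<Rightarrow> ('a \<Rightarrow> real) \<Rightarrow> real" where
  "sup_norm \<Omega> f = (SUP x\<in>\<Omega>. \<bar>f x\<bar>)"

text \<open>\<open>lin_dom\<close> and \<open>mob_dom\<close> collect the functions regular enough for the classical
  (pointwise) application of \<open>lin_op\<close> and of \<open>mobility\<close>, respectively; functions in \<open>lin_dom\<close>
  are also regular enough for \<open>nl_energy\<close>, \<open>nl_deriv\<close> and \<open>stab_op\<close>.\<close>

record 'a phase_model =
  mobility :: "('a \<Rightarrow> real) \<Rightarrow> 'a \<Rightarrow> real"        \<comment> \<open>\<open>\<G>\<close>\<close>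
  mob_dom :: "('a \<Rightarrow> real) set"
  lin_op :: "('a \<Rightarrow> real) \<Rightarrow> 'a \<Rightarrow> real"          \<comment> \<open>\<open>\<L>\<close>\<close>
  lin_dom :: "('a \<Rightarrow> real) set"
  nl_energy :: "('a \<Rightarrow> real) \<Rightarrow> real"            \<comment> \<open>\<open>E\<^sub>1\<close>\<close>
  nl_deriv :: "('a \<Rightarrow> real) \<Rightarrow> 'a \<Rightarrow> real"        \<comment> \<open>variational derivative of \<open>E\<^sub>1\<close> in \<open>L\<^sup>2\<close>\<close>
  stab_op :: "('a \<Rightarrow> real) \<Rightarrow> 'a \<Rightarrow> real"         \<comment> \<open>stabilization operator\<close>

definition double_well :: "real \<Rightarrow> real" where
  "double_well s = 1/4 * (1 - s\<^sup>2)\<^sup>2"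

definition truncated_double_well :: "real \<Rightarrow> (real \<Rightarrow> real) \<Rightarrow> bool" where
  "truncated_double_well L F \<longleftrightarrow>
     Ck 2 F \<and> (\<exists>M>0. \<forall>s. \<bar>s\<bar> \<le> M \<longrightarrow> F s = double_well s) \<and> (\<forall>s. \<bar>deriv (deriv F) s\<bar> \<le> L)"

definition allen_cahn :: "'a::euclidean_space set \<Rightarrow> real \<Rightarrow> real \<Rightarrow> 'a phase_model" where
  "allen_cahn \<Omega> \<epsilon> S =
    \<lparr> mobility = (\<lambda>\<mu> x. - \<mu> x),
      mob_dom = UNIV,
      lin_op = (\<lambda>f x. - \<epsilon>\<^sup>2 * laplacian f x),
      lin_dom = {f. Ck 2 f},
      nl_energy = (\<lambda>f. integral \<Omega> (\<lambda>x. double_well (f x))),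
      nl_deriv = (\<lambda>f x. (f x)^3 - f x),
      stab_op = (\<lambda>f x. S * f x) \<rparr>"

text \<open>As \<open>F\<close> is merely \<open>C\<^sup>2\<close>, the single terms of the chemical potential need not be \<open>C\<^sup>2\<close>
  even for smooth states; \<open>mob_dom\<close> only requires this of the chemical potential as a whole.\<close>

definition cahn_hilliard ::
    "'a::euclidean_space set \<Rightarrow> real \<Rightarrow> (real \<Rightarrow> real) \<Rightarrow> real \<Rightarrow> 'a phase_model" where
  "cahn_hilliard \<Omega> \<epsilon> F S =
    \<lparr> mobility = laplacian,
      mob_dom = {\<mu>. Ck 2 \<mu>},
      lin_op = (\<lambda>f x. - \<epsilon>\<^sup>2 * laplacian f x),
      lin_dom = {f. Ck 2 f},
      nl_energy = (\<lambda>f. integral \<Omega> (\<lambda>x. F (f x))),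
      nl_deriv = (\<lambda>f x. deriv F (f x)),
      stab_op = (\<lambda>f x. S * f x) \<rparr>"

definition mbe_no_slope_selection ::
    "'a::euclidean_space set \<Rightarrow> real \<Rightarrow> real \<Rightarrow> 'a phase_model" where
  "mbe_no_slope_selection \<Omega> \<epsilon> S =
    \<lparr> mobility = (\<lambda>\<mu> x. - \<mu> x),
      mob_dom = UNIV,
      lin_op = (\<lambda>f x. \<epsilon>\<^sup>2 * laplacian (laplacian f) x),
      lin_dom = {f. Ck 2 f \<and> Ck 2 (laplacian f)},
      nl_energy = (\<lambda>f. - (1/2) * integral \<Omega> (\<lambda>x. ln (1 + (norm (grad f x))\<^sup>2))),
      nl_deriv = (\<lambda>f. divergence (\<lambda>x. grad f x /\<^sub>R (1 + (norm (grad f x))\<^sup>2))),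
      stab_op = (\<lambda>f x. - S * laplacian f x) \<rparr>"

definition energy :: "'a::euclidean_space set \<Rightarrow> 'a phase_model \<Rightarrow> ('a \<Rightarrow> real) \<Rightarrow> real" where
  "energy \<Omega> m f = 1/2 * L2_inner \<Omega> f (lin_op m f) + nl_energy m f"

text \<open>The argument of \<open>\<G>\<close> in the step from \<open>f = \<phi>\<^sup>n\<close> to \<open>g\<close>, the state at level \<open>n + 1\<close>.\<close>

definition chem_potential ::
    "'a phase_model \<Rightarrow> ('a \<Rightarrow> real) \<Rightarrow> ('a \<Rightarrow> real) \<Rightarrow> 'a \<Rightarrow> real" where
  "chem_potential m g f x = lin_op m g x + nl_deriv m f x + stab_op m (\<lambda>y. g y - f y) x"

definition L1_scheme_solution ::
    "'a \<Rightarrow> 'a \<Rightarrow> 'a::euclidean_space phase_model \<Rightarrow> real \<Rightarrow> real \<Rightarrow> real \<Rightarrow> nat \<Rightarrow>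
     (nat \<Rightarrow> 'a \<Rightarrow> real) \<Rightarrow> bool" where
  "L1_scheme_solution a b m \<alpha> \<gamma> dt N \<phi> \<longleftrightarrow>
     (\<forall>n\<le>N. box_periodic a b (\<phi> n) \<and> \<phi> n \<in> lin_dom m) \<and>
     (\<forall>n<N. chem_potential m (\<phi> (n + 1)) (\<phi> n) \<in> mob_dom m) \<and>
     (\<forall>n<N. \<forall>x. L1_caputo \<alpha> dt (\<lambda>k. \<phi> k x) (n + 1)
        = \<gamma> * mobility m (chem_potential m (\<phi> (n + 1)) (\<phi> n)) x)"

end

theory Submission
  imports Defs
begin

text \<open>
  Write \<open>d\<^sub>k = \<phi>\<^sub>k - \<phi>\<^sub>k\<^sub>-\<^sub>1\<close> for the increments and \<open>\<mu>\<^sub>k\<close> for the chemical potential of the step that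
  ends at level \<open>k\<close>. The proof has two independent ingredients.

  The first is the one-step inequality \<open>E\<^sub>k - E\<^sub>k\<^sub>-\<^sub>1 \<le> \<integral> \<mu>\<^sub>k d\<^sub>k\<close>. The quadratic part of the energy is
  convex and taken implicitly; the nonlinear part is taken explicitly, and the error of its
  linearization is at most the contribution of the stabilization
  (\<open>second_order_energy_descent\<close>, \<open>fourth_order_energy_descent\<close>). For the double well
  this needs \<open>|\<phi>\<^sub>k| \<le> 1\<close>, which is a maximum principle for the scheme (\<open>allen_cahn_bounded\<close>).

  The second is a positivity property of the L1 weights \<open>b\<^sub>j\<close>. The weighted sum of the bounds
  \<open>\<integral> \<mu>\<^sub>k d\<^sub>k\<close> over \<open>k \<le> n\<close> has to be nonpositive. If the mobility is \<open>-1\<close>, the scheme expresses \<open>\<mu>\<^sub>k\<close> by the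
  convolution of the weights with the increments, and this becomes the pointwise statement
  \<open>(\<Sum>k = 1..n. \<Sum>j = 1..k. b\<^sub>n\<^sub>-\<^sub>k b\<^sub>k\<^sub>-\<^sub>j d\<^sub>j d\<^sub>k) \<ge> 0\<close>.
  If the mobility is the Laplacian, \<open>d\<^sub>k\<close> is the Laplacian of a periodic potential \<open>\<psi>\<^sub>k\<close>, which is
  obtained from the \<open>\<mu>\<^sub>j\<close> by inverting the convolution (\<open>triangular_laplacian_potentials\<close>); after
  integration by parts the same form appears with \<open>grad \<psi>\<^sub>k\<close> in place of \<open>d\<^sub>k\<close>.

  The form is nonnegative because the weights are positive, decreasing and log-convex
  (\<open>log_convex_convolution_form_nonneg\<close>). The rescaling \<open>y\<^sub>k = b\<^sub>n\<^sub>-\<^sub>k d\<^sub>k\<close> turns the kernel into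
  \<open>b\<^sub>k\<^sub>-\<^sub>j / b\<^sub>n\<^sub>-\<^sub>j\<close>, which decreases in \<open>k\<close> and whose decrements in \<open>k\<close> increase with \<open>j\<close>. Such a kernel is a
  combination with nonnegative coefficients of kernels of intervals \<open>{i..l}\<close>, so up to a
  nonnegative diagonal part the form is a nonnegative combination of squares of sums of consecutive
  \<open>y\<^sub>k\<close>; summation by parts gives its sign directly (\<open>triangular_form_nonneg\<close>). Log-convexity of
  the weights is inherited from \<open>x powr (-\<alpha>)\<close>: up to a constant factor they are the averages of this
  function over unit intervals.

  All integrals are over a period box, and integration by parts rests on
  \<open>integral_partial_eq_0\<close>: the integral of a periodic function over a translated box does not depend on
  the translation.
\<close>

section \<open>Classical partial derivatives\<close>

lemma partial_eqI: "(f has_derivative f') (at x) \<Longrightarrow> partial i f x = f' i"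
  unfolding partial_def using frechet_derivative_at by metis

lemma partial_const: "partial i (\<lambda>x. c) = (\<lambda>x. 0)"
  by (intro ext partial_eqI[where f' = "\<lambda>_. 0", OF has_derivative_const])

lemma partial_add:
  assumes "f differentiable (at x)" "g differentiable (at x)"
  shows "partial i (\<lambda>x. f x + g x) x = partial i f x + partial i g x"
  using partial_eqI[OF has_derivative_add[OF assms[unfolded frechet_derivative_works]]]
  by (simp add: partial_def)

lemma partial_cmult:
  assumes "f differentiable (at x)"
  shows "partial i (\<lambda>x. c * f x) x = c * partial i f x"
  using partial_eqI[OF has_derivative_mult_right[OF assms[unfolded frechet_derivative_works]]]
  by (simp add: partial_def)

lemma partial_mult:
  fixes f g :: "'a::euclidean_space \<Rightarrow> real"
  assumes "f differentiable (at x)" "g differentiable (at x)"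
  shows "partial i (\<lambda>x. f x * g x) x = f x * partial i g x + partial i f x * g x"
  using partial_eqI[OF has_derivative_mult[OF assms[unfolded frechet_derivative_works]]]
  by (simp add: partial_def)

lemma partial_inverse:
  fixes f :: "'a::euclidean_space \<Rightarrow> real"
  assumes "f differentiable (at x)" "f x \<noteq> 0"
  shows "partial i (\<lambda>x. inverse (f x)) x = - (inverse (f x) * partial i f x * inverse (f x))"
  using partial_eqI[OF Deriv.has_derivative_inverse[OF assms(2) assms(1)[unfolded frechet_derivative_works]]]
  by (simp add: partial_def)

lemma Ck_1_iff:
  "Ck 1 f \<longleftrightarrow> (\<forall>x. f differentiable (at x)) \<and> (\<forall>i\<in>Basis. continuous_on UNIV (partial i f))"
  by simp

lemma Ck_2_iff:
  "Ck 2 f \<longleftrightarrow> (\<forall>x. f differentiable (at x)) \<and> (\<forall>i\<in>Basis. Ck 1 (partial i f))"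
  by (simp add: numeral_2_eq_2)

lemma Ck_1_continuous: "Ck 1 f \<Longrightarrow> continuous_on A f"
  by (simp add: continuous_at_imp_continuous_on differentiable_imp_continuous_within)

lemma Ck_1_partial_continuous:
  "Ck 1 f \<Longrightarrow> i \<in> Basis \<Longrightarrow> continuous_on A (partial i f)"
  by (metis Ck_1_iff continuous_on_subset subset_UNIV)

lemma Ck_2_imp_Ck_1: "Ck 2 f \<Longrightarrow> Ck 1 f"
  unfolding Ck_2_iff Ck_1_iff[of f] using Ck_1_continuous by blast

lemma Ck_const: "Ck k (\<lambda>x. c)"
  by (induction k arbitrary: c) (auto simp: partial_const)

lemma Ck_add: "Ck k f \<Longrightarrow> Ck k g \<Longrightarrow> Ck k (\<lambda>x. f x + g x)"
proof (induction k arbitrary: f g)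
  case (Suc k)
  then have "partial i (\<lambda>x. f x + g x) = (\<lambda>x. partial i f x + partial i g x)" for i
    by (auto intro!: partial_add)
  with Suc show ?case by auto
qed (auto intro: continuous_intros)

lemma Ck_cmult: "Ck k f \<Longrightarrow> Ck k (\<lambda>x. c * f x)"
proof (induction k arbitrary: f)
  case (Suc k)
  then have "partial i (\<lambda>x. c * f x) = (\<lambda>x. c * partial i f x)" for i
    by (auto intro!: partial_cmult)
  with Suc show ?case by auto
qed (auto intro: continuous_intros)

lemma Ck_diff: "Ck k f \<Longrightarrow> Ck k g \<Longrightarrow> Ck k (\<lambda>x. f x - g x)"
  using Ck_add[of k f "\<lambda>x. -1 * g x"] Ck_cmult[of k g "-1"] by simp

lemma Ck_sum: "(\<And>j. j \<in> J \<Longrightarrow> Ck k (f j)) \<Longrightarrow> Ck k (\<lambda>x. \<Sum>j\<in>J. f j x)"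
  by (induction J rule: infinite_finite_induct) (auto intro: Ck_add Ck_const)

lemma Ck_1_mult:
  fixes f g :: "'a::euclidean_space \<Rightarrow> real"
  assumes "Ck 1 f" "Ck 1 g" shows "Ck 1 (\<lambda>x. f x * g x)"
proof -
  have d: "f differentiable (at x)" "g differentiable (at x)" for x using assms by simp_all
  have "partial i (\<lambda>x. f x * g x) = (\<lambda>x. f x * partial i g x + partial i f x * g x)" for i
    by (intro ext partial_mult d)
  then show ?thesis
    unfolding Ck_1_iff using assms d
    by (auto intro!: continuous_intros Ck_1_continuous[OF assms(1)] Ck_1_continuous[OF assms(2)]
        simp del: Ck.simps One_nat_def simp: Ck_1_partial_continuous)
qed

lemma Ck_1_inverse:
  fixes f :: "'a::euclidean_space \<Rightarrow> real"
  assumes "Ck 1 f" "\<And>x. f x \<noteq> 0" shows "Ck 1 (\<lambda>x. inverse (f x))"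
proof -
  have d: "f differentiable (at x)" for x using assms by simp
  have "partial i (\<lambda>x. inverse (f x)) = (\<lambda>x. - (inverse (f x) * partial i f x * inverse (f x)))" for i
    by (intro ext partial_inverse d assms)
  then show ?thesis
    unfolding Ck_1_iff using assms d
    by (auto intro!: continuous_intros Ck_1_continuous[OF assms(1)]
        simp del: Ck.simps One_nat_def simp: Ck_1_partial_continuous)
qed

lemma grad_inner_Basis: "i \<in> Basis \<Longrightarrow> grad f x \<bullet> i = partial i f x"
  unfolding grad_def by (simp add: inner_sum_left_Basis)

lemma inner_grad: "grad f x \<bullet> V = (\<Sum>i\<in>Basis. partial i f x * (V \<bullet> i))"
  unfolding grad_def by (simp add: inner_sum_left inner_commute[of V])

lemma grad_add:
  "f differentiable (at x) \<Longrightarrow> g differentiable (at x) \<Longrightarrow> grad (\<lambda>x. f x + g x) x = grad f x + grad g x"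
  by (simp add: grad_def partial_add scaleR_left_distrib sum.distrib)

lemma grad_cmult: "f differentiable (at x) \<Longrightarrow> grad (\<lambda>x. c * f x) x = c *\<^sub>R grad f x"
  by (simp add: grad_def partial_cmult scaleR_sum_right)

lemma grad_diff:
  "f differentiable (at x) \<Longrightarrow> g differentiable (at x) \<Longrightarrow> grad (\<lambda>x. f x - g x) x = grad f x - grad g x"
  using grad_add[of f x "\<lambda>x. -1 * g x"] grad_cmult[of g x "-1"] by simp

lemma grad_sum_cmult:
  assumes "\<And>j. j \<in> J \<Longrightarrow> f j differentiable (at x)"
  shows "grad (\<lambda>x. \<Sum>j\<in>J. c j * f j x) x = (\<Sum>j\<in>J. c j *\<^sub>R grad (f j) x)"
  using assms
proof (induction J rule: infinite_finite_induct)
  case (insert j J)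
  then show ?case by (simp add: grad_add grad_cmult)
qed (simp_all add: grad_def partial_const)

lemma grad_continuous: "Ck 1 f \<Longrightarrow> continuous_on A (grad f)"
  unfolding grad_def by (intro continuous_intros Ck_1_partial_continuous)

text \<open>A field with differentiable components is differentiable, so the trace that defines the
  divergence can be read off componentwise.\<close>

lemma divergence_eq_sum_partial:
  fixes V :: "'a::euclidean_space \<Rightarrow> 'a"
  assumes "\<And>i. i \<in> Basis \<Longrightarrow> (\<lambda>y. V y \<bullet> i) differentiable (at x)"
  shows "divergence V x = (\<Sum>i\<in>Basis. partial i (\<lambda>y. V y \<bullet> i) x)"
proof -
  have "V differentiable (at x)"
    using assms by (subst differentiable_componentwise_within) auto
  then have V: "(V has_derivative frechet_derivative V (at x)) (at x)"
    by (simp add: frechet_derivative_works)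
  have "partial i (\<lambda>y. V y \<bullet> i) x = frechet_derivative V (at x) i \<bullet> i" for i
    by (intro partial_eqI[where f' = "\<lambda>h. frechet_derivative V (at x) h \<bullet> i"] has_derivative_inner_left V)
  then show ?thesis by (simp add: divergence_def)
qed

lemma continuous_divergence:
  fixes V :: "'a::euclidean_space \<Rightarrow> 'a"
  assumes "\<And>i. i \<in> Basis \<Longrightarrow> Ck 1 (\<lambda>x. V x \<bullet> i)"
  shows "continuous_on A (divergence V)"
proof -
  have "divergence V = (\<lambda>x. \<Sum>i\<in>Basis. partial i (\<lambda>y. V y \<bullet> i) x)"
    using assms by (intro ext divergence_eq_sum_partial) simp
  then show ?thesis using assms by (simp add: continuous_on_sum Ck_1_partial_continuous del: Ck.simps One_nat_def)
qed

lemma laplacian_eq_sum_partial: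
  "Ck 2 f \<Longrightarrow> laplacian f x = (\<Sum>i\<in>Basis. partial i (partial i f) x)"
  unfolding laplacian_def
  by (subst divergence_eq_sum_partial) (simp_all add: grad_inner_Basis Ck_2_iff cong: sum.cong)

lemma laplacian_continuous: "Ck 2 f \<Longrightarrow> continuous_on A (laplacian f)"
proof -
  assume f: "Ck 2 f"
  then have "laplacian f = (\<lambda>x. \<Sum>i\<in>Basis. partial i (partial i f) x)"
    using laplacian_eq_sum_partial by blast
  with f show ?thesis by (auto intro!: continuous_intros Ck_1_partial_continuous simp: Ck_2_iff)
qed

lemma laplacian_add:
  assumes "Ck 2 f" "Ck 2 g" shows "laplacian (\<lambda>x. f x + g x) x = laplacian f x + laplacian g x"
proof -
  have "partial i (\<lambda>x. f x + g x) = (\<lambda>x. partial i f x + partial i g x)" for i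
    using assms by (auto intro!: partial_add simp: Ck_2_iff)
  then have "partial i (partial i (\<lambda>x. f x + g x)) x = partial i (partial i f) x + partial i (partial i g) x"
    if "i \<in> Basis" for i using that assms by (auto intro!: partial_add simp: Ck_2_iff)
  then show ?thesis using assms by (simp add: laplacian_eq_sum_partial Ck_add sum.distrib)
qed

lemma laplacian_cmult:
  assumes "Ck 2 f" shows "laplacian (\<lambda>x. c * f x) x = c * laplacian f x"
proof -
  have "partial i (\<lambda>x. c * f x) = (\<lambda>x. c * partial i f x)" for i
    using assms by (auto intro!: partial_cmult simp: Ck_2_iff)
  then have "partial i (partial i (\<lambda>x. c * f x)) x = c * partial i (partial i f) x"
    if "i \<in> Basis" for i using that assms by (auto intro!: partial_cmult simp: Ck_2_iff)
  then show ?thesis using assms by (simp add: laplacian_eq_sum_partial Ck_cmult sum_distrib_left)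
qed

lemma laplacian_diff:
  "Ck 2 f \<Longrightarrow> Ck 2 g \<Longrightarrow> laplacian (\<lambda>x. f x - g x) x = laplacian f x - laplacian g x"
  using laplacian_add[of f "\<lambda>x. -1 * g x"] laplacian_cmult[of g "-1"] Ck_cmult[of 2 g "-1"] by simp

lemma laplacian_const: "laplacian (\<lambda>x. c) x = 0"
  by (subst laplacian_eq_sum_partial) (simp_all add: Ck_const partial_const)

lemma laplacian_sum:
  "(\<And>j. j \<in> J \<Longrightarrow> Ck 2 (f j)) \<Longrightarrow> laplacian (\<lambda>x. \<Sum>j\<in>J. f j x) x = (\<Sum>j\<in>J. laplacian (f j) x)"
  by (induction J rule: infinite_finite_induct) (auto simp: laplacian_const laplacian_add Ck_sum)

lemma has_real_derivative_along:
  fixes f :: "'a::euclidean_space \<Rightarrow> real"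
  assumes "\<And>x. f differentiable (at x)"
  shows "((\<lambda>t. f (x + t *\<^sub>R v)) has_real_derivative partial v f (x + t *\<^sub>R v)) (at t within U)"
proof -
  have f: "(f has_derivative frechet_derivative f (at (x + t *\<^sub>R v))) (at (x + t *\<^sub>R v))"
    using assms by (simp add: frechet_derivative_works)
  have "((\<lambda>t. x + t *\<^sub>R v) has_derivative (\<lambda>h. h *\<^sub>R v)) (at t within U)"
    by (auto intro!: derivative_eq_intros)
  from has_derivative_compose[OF this f]
  have "((\<lambda>t. f (x + t *\<^sub>R v)) has_derivative (\<lambda>h. frechet_derivative f (at (x + t *\<^sub>R v)) (h *\<^sub>R v))) (at t within U)" .
  moreover have "frechet_derivative f (at (x + t *\<^sub>R v)) (h *\<^sub>R v) = partial v f (x + t *\<^sub>R v) * h" for h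
    using f has_derivative_linear linear_scale[of "frechet_derivative f (at (x + t *\<^sub>R v))"]
    unfolding partial_def by (simp add: has_derivative_linear[OF f, THEN linear_scale])
  ultimately show ?thesis by (simp add: has_field_derivative_def)
qed

text \<open>Were the second derivative positive, the first one, which vanishes at the maximum, would be
  positive just to the right of it, and \<open>f\<close> would grow beyond its maximum.\<close>

lemma partial2_nonpos_at_max:
  assumes f: "Ck 2 f" and i: "i \<in> Basis" and max: "\<And>y. f y \<le> f x"
  shows "partial i (partial i f) x \<le> 0"
proof (rule ccontr)
  assume "\<not> ?thesis"
  then have pos: "0 < partial i (partial i f) x" by simp
  define g g' where "g t = f (x + t *\<^sub>R i)" and "g' t = partial i f (x + t *\<^sub>R i)" for t
  have g: "(g has_real_derivative g' t) (at t)" for t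
    unfolding g_def g'_def using f by (intro has_real_derivative_along) (simp add: Ck_2_iff)
  have g': "(g' has_real_derivative partial i (partial i f) x) (at 0)"
    unfolding g'_def using f i has_real_derivative_along[of "partial i f" x i 0 UNIV] by (simp add: Ck_2_iff)
  have "g' 0 = 0"
    using DERIV_local_max[OF g[of 0], of 1] max by (simp add: g_def)
  then obtain d where d: "0 < d" "\<And>h. 0 < h \<Longrightarrow> h < d \<Longrightarrow> 0 < g' h"
    using DERIV_pos_inc_right[OF g' pos] by auto
  have "g 0 < g (d / 2)"
  proof (rule DERIV_pos_imp_increasing_open[of 0 "d / 2" g])
    show "continuous_on {0..d / 2} g" using g DERIV_continuous_on by (metis has_field_derivative_at_within)
    show "\<exists>y. (g has_real_derivative y) (at t) \<and> 0 < y" if "0 < t" "t < d / 2" for t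
      using g[of t] d that by (intro exI[of _ "g' t"]) simp
  qed (use d in simp)
  then show False using max by (simp add: g_def not_le[symmetric])
qed

lemma laplacian_nonpos_at_max:
  "Ck 2 f \<Longrightarrow> (\<And>y. f y \<le> f x) \<Longrightarrow> laplacian f x \<le> 0"
  by (simp add: laplacian_eq_sum_partial sum_nonpos partial2_nonpos_at_max)

text \<open>Applied along a segment between two states, this converts a bound on the second derivative of an
  energy density into the size of the stabilization constant that absorbs the explicit treatment
  of the density.\<close>

lemma taylor_second_order_bound:
  fixes h :: "real \<Rightarrow> real"
  assumes "\<And>t. (h has_real_derivative h' t) (at t)" "\<And>t. (h' has_real_derivative h'' t) (at t)"
    and "\<And>t. h'' t \<le> c"
  shows "h 1 \<le> h 0 + h' 0 + c / 2"
proof -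
  define D where "D m = (if m = 0 then h else if m = 1 then h' else h'')" for m :: nat
  have "\<exists>t>0. t < 1 \<and> h 1 = (\<Sum>m<2. D m 0 / fact m * (1 - 0) ^ m) + D 2 t / fact 2 * (1 - 0) ^ 2"
    by (rule Taylor_up[of 2 D h 0 1 0]) (auto simp: D_def assms less_2_cases_iff)
  then show ?thesis using assms(3) by (auto simp: D_def numeral_2_eq_2 divide_right_mono)
qed

lemma Ck_2_real_derivs:
  fixes F :: "real \<Rightarrow> real"
  assumes "Ck 2 F"
  shows "(F has_real_derivative deriv F s) (at s)" "(deriv F has_real_derivative deriv (deriv F) s) (at s)"
proof -
  have F: "(F has_real_derivative deriv F s) (at s)" for s
    using assms by (simp add: Ck_2_iff DERIV_deriv_iff_real_differentiable)
  then have "partial 1 F = deriv F"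
    using partial_eqI[OF F[unfolded has_field_derivative_def]] by auto
  then have "deriv F differentiable (at s)" using assms by (simp add: Ck_2_iff)
  then show "(F has_real_derivative deriv F s) (at s)" "(deriv F has_real_derivative deriv (deriv F) s) (at s)"
    using F by (simp_all add: DERIV_deriv_iff_real_differentiable)
qed

section \<open>Periodic functions and integration by parts\<close>

lemma box_periodic_diff:
  "box_periodic a b u \<Longrightarrow> box_periodic a b v \<Longrightarrow> box_periodic a b (\<lambda>x. u x - v x)"
  by (simp add: box_periodic_def)

lemma partial_shift:
  fixes f :: "'a::euclidean_space \<Rightarrow> real"
  assumes "\<And>y. f (y + p) = f y" "f differentiable (at x)"
  shows "partial i f (x + p) = partial i f x"
proof -
  have "(f has_derivative frechet_derivative f (at x)) (at (x + p - p))"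
    using assms(2) by (simp add: frechet_derivative_works)
  moreover have "((\<lambda>y. y - p) has_derivative (\<lambda>h. h)) (at (x + p))"
    by (auto intro!: derivative_eq_intros)
  ultimately have "((\<lambda>y. f (y - p)) has_derivative frechet_derivative f (at x)) (at (x + p))"
    using has_derivative_compose[of "\<lambda>y. y - p" "\<lambda>h. h" "x + p" UNIV f] by simp
  moreover have "(\<lambda>y. f (y - p)) = f" using assms(1)[of "_ - p"] by simp
  ultimately show ?thesis unfolding partial_def by (simp add: frechet_derivative_at[symmetric])
qed

lemma box_periodic_partial:
  "box_periodic a b f \<Longrightarrow> (\<And>x. f differentiable (at x)) \<Longrightarrow> box_periodic a b (partial j f)"
  unfolding box_periodic_def using partial_shift by blast

lemma box_periodic_grad:
  assumes "box_periodic a b f" "\<And>x. f differentiable (at x)" "i \<in> Basis"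
  shows "grad f (x + ((b - a) \<bullet> i) *\<^sub>R i) = grad f x"
  using box_periodic_partial[OF assms(1,2)] assms(3)
  unfolding box_periodic_def grad_def by simp

lemma box_periodic_laplacian: "box_periodic a b f \<Longrightarrow> Ck 2 f \<Longrightarrow> box_periodic a b (laplacian f)"
proof -
  assume "box_periodic a b f" "Ck 2 f"
  then have "box_periodic a b (partial i (partial i f))" if "i \<in> Basis" for i
    using that by (intro box_periodic_partial) (auto simp: Ck_2_iff)
  with \<open>Ck 2 f\<close> show ?thesis by (simp add: box_periodic_def laplacian_eq_sum_partial)
qed

lemma box_periodic_int_multiple:
  fixes a b :: "'a::euclidean_space" and f :: "'a \<Rightarrow> real"
  assumes f: "box_periodic a b f" and i: "i \<in> Basis"
  shows "f (x + (of_int z * ((b - a) \<bullet> i)) *\<^sub>R i) = f x"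
proof -
  have nat: "f (y + (of_nat n * ((b - a) \<bullet> i)) *\<^sub>R i) = f y" for n y
  proof (induction n)
    case (Suc n)
    have "y + (of_nat (Suc n) * ((b - a) \<bullet> i)) *\<^sub>R i
        = y + (of_nat n * ((b - a) \<bullet> i)) *\<^sub>R i + ((b - a) \<bullet> i) *\<^sub>R i"
      by (simp add: algebra_simps)
    then show ?case using f i Suc by (metis box_periodic_def)
  qed simp
  show ?thesis
  proof (cases z)
    case (nonneg n) then show ?thesis using nat[of x n] by simp
  next
    case (neg n)
    define y where "y = x + (of_int z * ((b - a) \<bullet> i)) *\<^sub>R i"
    have yx: "y + (of_nat (Suc n) * ((b - a) \<bullet> i)) *\<^sub>R i = x"
      unfolding y_def neg by (simp add: algebra_simps del: of_nat_Suc)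
    then show ?thesis using nat[of y "Suc n", unfolded yx] unfolding y_def by simp
  qed
qed

lemma cbox_cut_above:
  fixes p q i :: "'a::euclidean_space"
  assumes i: "i \<in> Basis" and c: "c \<le> q \<bullet> i"
  shows "cbox p q \<inter> {x. x \<bullet> i \<le> c} = cbox p (q + (c - q \<bullet> i) *\<^sub>R i)"
proof -
  have split: "(\<forall>j\<in>Basis. P j) \<longleftrightarrow> P i \<and> (\<forall>j\<in>Basis - {i}. P j)" for P using i by auto
  have "i \<bullet> j = 0" if "j \<in> Basis - {i}" for j using i that by (auto simp: inner_Basis)
  then show ?thesis
    unfolding set_eq_iff Int_iff mem_box mem_Collect_eq using i c
    by (subst (1 2) split) (auto simp: inner_add_left)
qed

lemma cbox_cut_below:
  fixes p q i :: "'a::euclidean_space"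
  assumes i: "i \<in> Basis" and c: "p \<bullet> i \<le> c"
  shows "cbox p q \<inter> {x. c \<le> x \<bullet> i} = cbox (p + (c - p \<bullet> i) *\<^sub>R i) q"
proof -
  have split: "(\<forall>j\<in>Basis. P j) \<longleftrightarrow> P i \<and> (\<forall>j\<in>Basis - {i}. P j)" for P using i by auto
  have "i \<bullet> j = 0" if "j \<in> Basis - {i}" for j using i that by (auto simp: inner_Basis)
  then show ?thesis
    unfolding set_eq_iff Int_iff mem_box mem_Collect_eq using i c
    by (subst (1 2) split) (auto simp: inner_add_left)
qed

lemma continuous_integrable_cbox:
  fixes f :: "'a::euclidean_space \<Rightarrow> real"
  shows "continuous_on UNIV f \<Longrightarrow> f integrable_on cbox a b"
  by (meson continuous_on_subset integrable_continuous subset_UNIV)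

text \<open>The translated box consists of the upper part of the original box and of the lower part moved up
  by one period.\<close>

lemma integral_shift_box_periodic:
  fixes a b :: "'a::euclidean_space" and f :: "'a \<Rightarrow> real"
  assumes f: "box_periodic a b f" "continuous_on UNIV f" and i: "i \<in> Basis"
    and t: "0 \<le> t" "t \<le> (b - a) \<bullet> i"
  shows "integral (cbox a b) (\<lambda>x. f (x + t *\<^sub>R i)) = integral (cbox a b) f"
proof -
  define w where "w = (b - a) \<bullet> i"
  \<comment> \<open>\<open>cbox a b1\<close> is the part of the box below height \<open>a \<bullet> i + t\<close>, and \<open>cbox a2 b\<close> is the rest.\<close>
  define b1 a2 where "b1 = b + (t - w) *\<^sub>R i" and "a2 = a + t *\<^sub>R i"
  note I = continuous_integrable_cbox[OF f(2), THEN integrable_integral]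
  have wab: "w = b \<bullet> i - a \<bullet> i" by (simp add: w_def inner_diff_left)
  have ii: "i \<bullet> i = 1" using i by simp
  have cut: "a \<bullet> i + t - b \<bullet> i = t - w" using wab by simp
  have P1: "cbox a b \<inter> {x. x \<bullet> i \<le> a \<bullet> i + t} = cbox a b1"
    using cbox_cut_above[OF i, of "a \<bullet> i + t" b a] t wab
    unfolding b1_def cut w_def by (simp add: inner_diff_left)
  have P2: "cbox a b \<inter> {x. x \<bullet> i \<ge> a \<bullet> i + t} = cbox a2 b"
    using cbox_cut_below[OF i, of a "a \<bullet> i + t" b] t by (simp add: a2_def)
  have Q1: "cbox a2 (b + t *\<^sub>R i) \<inter> {x. x \<bullet> i \<le> b \<bullet> i} = cbox a2 b"
    using cbox_cut_above[OF i, of "b \<bullet> i" "b + t *\<^sub>R i" a2] t by (simp add: inner_add_left ii)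
  have Q2: "cbox a2 (b + t *\<^sub>R i) \<inter> {x. x \<bullet> i \<ge> b \<bullet> i} = cbox (a + w *\<^sub>R i) (b1 + w *\<^sub>R i)"
    using cbox_cut_below[OF i, of a2 "b \<bullet> i" "b + t *\<^sub>R i"] t wab
    by (simp add: inner_add_left inner_diff_left w_def ii a2_def b1_def algebra_simps)
  have "f \<circ> (+) (w *\<^sub>R i) = f"
    using f(1) i by (auto simp: box_periodic_def w_def add.commute)
  then have shift: "integral (cbox (a + w *\<^sub>R i) (b1 + w *\<^sub>R i)) f = integral (cbox a b1) f"
    using integral_shift_cbox_plus[of a b1 f "w *\<^sub>R i"] by simp
  have "integral (cbox a b) (\<lambda>x. f (x + t *\<^sub>R i)) = integral (cbox a2 (b + t *\<^sub>R i)) f"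
    using integral_shift_cbox_plus[of a b f "t *\<^sub>R i"] by (simp add: o_def a2_def add.commute)
  also have "\<dots> = integral (cbox a2 b) f + integral (cbox a b1) f"
    using has_integral_split[OF I[of a2 b, folded Q1] I[of "a + w *\<^sub>R i" "b1 + w *\<^sub>R i", folded Q2] i]
    by (simp add: Q1 Q2 shift integral_unique)
  also have "\<dots> = integral (cbox a b) f"
    using integral_unique[OF has_integral_split[OF I[of a b1, folded P1] I[of a2 b, folded P2] i]]
    unfolding P1 P2 by simp
  finally show ?thesis .
qed

context
  fixes a b :: "'a::euclidean_space"
  assumes ab: "\<forall>i\<in>Basis. a \<bullet> i < b \<bullet> i"
begin

text \<open>Moving each coordinate by the right number of periods brings \<open>x\<close> into the box.\<close>

lemma box_periodic_attained_in_box: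
  assumes "box_periodic a b f"
  shows "\<exists>y\<in>cbox a b. f y = f x"
proof -
  define z where "z i = - \<lfloor>(x - a) \<bullet> i / ((b - a) \<bullet> i)\<rfloor>" for i
  have "f (x + (\<Sum>i\<in>B. (of_int (z i) * ((b - a) \<bullet> i)) *\<^sub>R i)) = f x" if "finite B" "B \<subseteq> Basis" for B
    using that
  proof (induction B rule: finite_induct)
    case (insert j B)
    then show ?case
      using box_periodic_int_multiple[OF assms, of j "x + (\<Sum>i\<in>B. (of_int (z i) * ((b - a) \<bullet> i)) *\<^sub>R i)" "z j"]
      by (simp add: add_ac)
  qed simp
  from this[of Basis] have "f (x + (\<Sum>i\<in>Basis. (of_int (z i) * ((b - a) \<bullet> i)) *\<^sub>R i)) = f x" by simp
  moreover have "x + (\<Sum>i\<in>Basis. (of_int (z i) * ((b - a) \<bullet> i)) *\<^sub>R i) \<in> cbox a b"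
  proof (unfold mem_box, intro ballI)
    fix i :: 'a assume i: "i \<in> Basis"
    define w where "w = (b - a) \<bullet> i"
    define q where "q = (x - a) \<bullet> i / w"
    have w: "0 < w" using ab i by (simp add: w_def inner_diff_left)
    have x: "x \<bullet> i = a \<bullet> i + q * w" using w by (simp add: q_def inner_diff_left)
    have zq: "of_int (z i) = - (of_int \<lfloor>q\<rfloor> :: real)" by (simp add: z_def q_def w_def)
    have e: "(x + (\<Sum>i\<in>Basis. (of_int (z i) * ((b - a) \<bullet> i)) *\<^sub>R i)) \<bullet> i = a \<bullet> i + (q - of_int \<lfloor>q\<rfloor>) * w"
    proof -
      have "(\<Sum>i\<in>Basis. (of_int (z i) * ((b - a) \<bullet> i)) *\<^sub>R i) \<bullet> i = of_int (z i) * w"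
        using i by (simp only: inner_sum_left_Basis w_def)
      then show ?thesis using zq by (simp add: inner_add_left x left_diff_distrib)
    qed
    have "0 \<le> (q - of_int \<lfloor>q\<rfloor>) * w" "(q - of_int \<lfloor>q\<rfloor>) * w \<le> 1 * w"
      using w by (auto intro!: mult_right_mono simp: le_diff_eq) linarith+
    then show "a \<bullet> i \<le> (x + (\<Sum>i\<in>Basis. (of_int (z i) * ((b - a) \<bullet> i)) *\<^sub>R i)) \<bullet> i \<and>
        (x + (\<Sum>i\<in>Basis. (of_int (z i) * ((b - a) \<bullet> i)) *\<^sub>R i)) \<bullet> i \<le> b \<bullet> i"
      unfolding e by (simp add: w_def inner_diff_left)
  qed
  ultimately show ?thesis by blast
qed

lemma box_periodic_has_max:
  assumes "box_periodic a b f" "continuous_on UNIV f"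
  obtains x where "\<And>y. f y \<le> f x"
proof -
  have "cbox a b \<noteq> {}" using ab by (auto simp: box_ne_empty less_imp_le)
  then obtain x where "\<And>y. y \<in> cbox a b \<Longrightarrow> f y \<le> f x"
    using continuous_attains_sup[OF compact_cbox _ continuous_on_subset[OF assms(2) subset_UNIV]] by blast
  \<comment> \<open>a maximum over the box is a maximum over the whole space\<close>
  then have "f y \<le> f x" for y using box_periodic_attained_in_box[OF assms(1), of y] by metis
  then show ?thesis using that by blast
qed

text \<open>By periodicity the integral of \<open>f (x + t i)\<close> over the box is independent of \<open>t\<close>;
  differentiating under the integral sign, its derivative is the integral of the partial derivative.
  All boundary terms in later integrations by parts vanish for this reason.\<close>

lemma integral_partial_eq_0:
  assumes f: "box_periodic a b f" "Ck 1 f" and i: "i \<in> Basis"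
  shows "integral (cbox a b) (partial i f) = 0"
proof -
  define w where "w = (b - a) \<bullet> i"
  have w: "0 < w" using ab i by (simp add: w_def inner_diff_left)
  have c: "continuous_on A f" "continuous_on A (partial i f)" for A
    using f i Ck_1_continuous Ck_1_partial_continuous by blast+
  have "((\<lambda>t. integral (cbox a b) (\<lambda>x. f (x + t *\<^sub>R i))) has_real_derivative
      integral (cbox a b) (\<lambda>x. partial i f (x + 0 *\<^sub>R i))) (at 0 within {0..w})"
  proof (rule leibniz_rule_field_derivative)
    show "((\<lambda>t. f (x + t *\<^sub>R i)) has_real_derivative partial i f (x + t *\<^sub>R i)) (at t within {0..w})" for t x
      using f by (intro has_real_derivative_along) simp
    show "(\<lambda>x. f (x + t *\<^sub>R i)) integrable_on cbox a b" for t
      by (intro continuous_integrable_cbox continuous_on_compose2[OF c(1)[of UNIV]] continuous_intros) auto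
    show "continuous_on ({0..w} \<times> cbox a b) (\<lambda>(t, x). partial i f (x + t *\<^sub>R i))"
      unfolding case_prod_beta
      by (intro continuous_on_compose2[OF c(2)[of UNIV]] continuous_intros) auto
  qed (use w in auto)
  moreover have "((\<lambda>t. integral (cbox a b) (\<lambda>x. f (x + t *\<^sub>R i))) has_real_derivative 0) (at 0 within {0..w})"
    by (rule has_field_derivative_transform_within[OF DERIV_const[of "integral (cbox a b) f"] zero_less_one])
      (use w in \<open>auto simp: integral_shift_box_periodic f c i w_def\<close>)
  ultimately have "integral (cbox a b) (\<lambda>x. partial i f (x + 0 *\<^sub>R i)) = 0"
    using vector_derivative_unique_within_closed_interval[of 0 w 0] w
    by (simp add: has_real_derivative_iff_has_vector_derivative) blast
  then show ?thesis by simp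
qed

lemma integral_mult_partial:
  assumes "box_periodic a b u" "Ck 1 u" "box_periodic a b v" "Ck 1 v" and i: "i \<in> Basis"
  shows "integral (cbox a b) (\<lambda>x. u x * partial i v x) = - integral (cbox a b) (\<lambda>x. partial i u x * v x)"
proof -
  have "0 = integral (cbox a b) (partial i (\<lambda>x. u x * v x))"
    using assms by (intro integral_partial_eq_0[symmetric] Ck_1_mult) (auto simp: box_periodic_def)
  also have "partial i (\<lambda>x. u x * v x) = (\<lambda>x. u x * partial i v x + partial i u x * v x)"
    using assms by (auto intro!: partial_mult)
  also have "integral (cbox a b) \<dots> = integral (cbox a b) (\<lambda>x. u x * partial i v x)
      + integral (cbox a b) (\<lambda>x. partial i u x * v x)"
    using assms by (intro integral_add continuous_integrable_cbox continuous_intros Ck_1_continuous Ck_1_partial_continuous)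
  finally show ?thesis by simp
qed

lemma integral_mult_divergence:
  fixes V :: "'a \<Rightarrow> 'a"
  assumes u: "box_periodic a b u" "Ck 1 u"
    and V: "\<And>i. i \<in> Basis \<Longrightarrow> box_periodic a b (\<lambda>x. V x \<bullet> i)" "\<And>i. i \<in> Basis \<Longrightarrow> Ck 1 (\<lambda>x. V x \<bullet> i)"
  shows "integral (cbox a b) (\<lambda>x. u x * divergence V x) = - integral (cbox a b) (\<lambda>x. grad u x \<bullet> V x)"
proof -
  have div: "divergence V x = (\<Sum>i\<in>Basis. partial i (\<lambda>y. V y \<bullet> i) x)" for x
    using V(2) by (intro divergence_eq_sum_partial) simp
  have "integral (cbox a b) (\<lambda>x. u x * divergence V x)
      = (\<Sum>i\<in>Basis. integral (cbox a b) (\<lambda>x. u x * partial i (\<lambda>y. V y \<bullet> i) x))"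
    unfolding div sum_distrib_left using u V
    by (intro integral_sum continuous_integrable_cbox continuous_intros Ck_1_continuous Ck_1_partial_continuous) auto
  also have "\<dots> = (\<Sum>i\<in>Basis. - integral (cbox a b) (\<lambda>x. partial i u x * (V x \<bullet> i)))"
    using u V by (intro sum.cong refl integral_mult_partial) auto
  also have "\<dots> = - integral (cbox a b) (\<lambda>x. \<Sum>i\<in>Basis. partial i u x * (V x \<bullet> i))"
    unfolding sum_negf using u V
    by (intro arg_cong[where f = uminus] integral_sum[symmetric] continuous_integrable_cbox continuous_intros
        Ck_1_continuous Ck_1_partial_continuous) auto
  finally show ?thesis by (simp add: inner_grad)
qed

lemma integral_mult_laplacian:
  assumes "box_periodic a b u" "Ck 1 u" "box_periodic a b v" "Ck 2 v"
  shows "integral (cbox a b) (\<lambda>x. u x * laplacian v x) = - integral (cbox a b) (\<lambda>x. grad u x \<bullet> grad v x)"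
  unfolding laplacian_def using assms
  by (intro integral_mult_divergence)
    (auto simp: grad_inner_Basis Ck_2_iff intro!: box_periodic_partial)

lemma integral_laplacian_symmetric:
  assumes "box_periodic a b u" "Ck 2 u" "box_periodic a b v" "Ck 2 v"
  shows "integral (cbox a b) (\<lambda>x. u x * laplacian v x) = integral (cbox a b) (\<lambda>x. v x * laplacian u x)"
  using integral_mult_laplacian[OF assms(1) Ck_2_imp_Ck_1[OF assms(2)] assms(3,4)]
    integral_mult_laplacian[OF assms(3) Ck_2_imp_Ck_1[OF assms(4)] assms(1,2)]
  by (simp add: inner_commute)

end

section \<open>Positivity of convolution quadratic forms\<close>

lemma sum_triangle_swap:
  fixes g :: "nat \<Rightarrow> nat \<Rightarrow> 'c::comm_monoid_add"
  shows "(\<Sum>k = 1..n. \<Sum>l = k..n. g k l) = (\<Sum>l = 1..n. \<Sum>k = 1..l. g k l)"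
proof -
  have "(\<Sum>k = 1..n. \<Sum>l = k..n. g k l) = (\<Sum>(k, l) \<in> Sigma {1..n} (\<lambda>k. {k..n}). g k l)"
    by (simp add: sum.Sigma)
  also have "\<dots> = (\<Sum>(l, k) \<in> Sigma {1..n} (\<lambda>l. {1..l}). g k l)"
    by (rule sum.reindex_bij_witness[of _ "\<lambda>(l, k). (k, l)" "\<lambda>(k, l). (l, k)"]) auto
  finally show ?thesis by (simp add: sum.Sigma)
qed

text \<open>With the tail sums \<open>T j\<close> one has \<open>y j = T j - T (j + 1)\<close>, hence
  \<open>y j \<bullet> T j \<ge> (|T j|\<^sup>2 - |T (j + 1)|\<^sup>2) / 2\<close>, and summation by parts moves the difference onto
  the nondecreasing weights. The downward induction proves the sharper lower bound
  \<open>D m |T m|\<^sup>2 / 2\<close> for the part of the sum that starts at \<open>m\<close>.\<close>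

lemma weighted_tail_sums_nonneg:
  fixes D :: "nat \<Rightarrow> real" and y :: "nat \<Rightarrow> 'v::real_inner"
  assumes "\<And>j. \<lbrakk>1 \<le> j; j \<le> l\<rbrakk> \<Longrightarrow> 0 \<le> D j"
    and "\<And>j. \<lbrakk>1 \<le> j; j < l\<rbrakk> \<Longrightarrow> D j \<le> D (Suc j)"
  shows "0 \<le> (\<Sum>j = 1..l. D j * (y j \<bullet> (\<Sum>k = j..l. y k)))"
proof (cases "l = 0")
  case False
  define T where "T j = (\<Sum>k = j..l. y k)" for j
  have "D m / 2 * (norm (T m))\<^sup>2 \<le> (\<Sum>j = m..l. D j * (y j \<bullet> T j))" if "m \<le> l" "1 \<le> m" for m
    using that
  proof (induction m rule: inc_induct)
    case base
    have "T l = y l" by (simp add: T_def)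
    moreover have "0 \<le> D l" using assms(1) False by simp
    ultimately show ?case by (simp add: power2_norm_eq_inner)
  next
    case (step m)
    have T: "T m = y m + T (Suc m)" unfolding T_def using step by (simp add: sum.atLeast_Suc_atMost)
    have "2 * (y m \<bullet> T m) = (norm (T m))\<^sup>2 - (norm (T (Suc m)))\<^sup>2 + (norm (y m))\<^sup>2"
      unfolding T power2_norm_eq_inner by (simp add: inner_commute inner_add_left inner_add_right)
    then have "D m / 2 * ((norm (T m))\<^sup>2 - (norm (T (Suc m)))\<^sup>2) \<le> D m / 2 * (2 * (y m \<bullet> T m))"
      using assms(1)[of m] step by (intro mult_left_mono) auto
    moreover have "D m / 2 * (norm (T (Suc m)))\<^sup>2 \<le> D (Suc m) / 2 * (norm (T (Suc m)))\<^sup>2"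
      using assms(2)[of m] step by (intro mult_right_mono) auto
    moreover have "D (Suc m) / 2 * (norm (T (Suc m)))\<^sup>2 \<le> (\<Sum>j = Suc m..l. D j * (y j \<bullet> T j))"
      using step by simp
    moreover have "(\<Sum>j = m..l. D j * (y j \<bullet> T j)) = D m * (y m \<bullet> T m) + (\<Sum>j = Suc m..l. D j * (y j \<bullet> T j))"
      using step by (simp add: sum.atLeast_Suc_atMost)
    ultimately show ?case by (simp add: right_diff_distrib)
  qed
  from this[of 1] False have "D 1 / 2 * (norm (T 1))\<^sup>2 \<le> (\<Sum>j = 1..l. D j * (y j \<bullet> T j))" by simp
  moreover have "0 \<le> D 1 / 2 * (norm (T 1))\<^sup>2" using assms(1)[of 1] False by simp
  ultimately show ?thesis by (simp add: T_def)
qed simp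

text \<open>Each entry telescopes, \<open>M k j = (\<Sum>l = k..n. D l j)\<close> with \<open>D l j = M l j - M (l + 1) j\<close>. Exchanging
  the sums leaves for every \<open>l\<close> a form with weights that depend on \<open>j\<close> only, and the hypotheses on
  \<open>M\<close> say that these weights are nonnegative and nondecreasing in \<open>j\<close>.\<close>

lemma triangular_form_nonneg:
  fixes M :: "nat \<Rightarrow> nat \<Rightarrow> real" and y :: "nat \<Rightarrow> 'v::real_inner"
  assumes last: "\<And>j. M (Suc n) j = 0"
    and decr: "\<And>l j. \<lbrakk>1 \<le> j; j \<le> l; l \<le> n\<rbrakk> \<Longrightarrow> M (Suc l) j \<le> M l j"
    and mixed: "\<And>l j. \<lbrakk>1 \<le> j; j < l; l \<le> n\<rbrakk> \<Longrightarrow> M l j - M (Suc l) j \<le> M l (Suc j) - M (Suc l) (Suc j)"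
  shows "0 \<le> (\<Sum>k = 1..n. \<Sum>j = 1..k. M k j * (y j \<bullet> y k))"
proof -
  define D where "D l j = M l j - M (Suc l) j" for l j
  have M: "M k j = (\<Sum>l = k..n. D l j)" if "k \<le> n" for k j
  proof -
    have "(\<Sum>l = k..n. M (Suc l) j - M l j) = M (Suc n) j - M k j"
      using that by (intro sum_Suc_diff) simp
    then show ?thesis by (simp add: D_def last sum_subtractf)
  qed
  have "(\<Sum>k = 1..n. \<Sum>j = 1..k. M k j * (y j \<bullet> y k))
      = (\<Sum>k = 1..n. \<Sum>l = k..n. \<Sum>j = 1..k. D l j * (y j \<bullet> y k))"
  proof (rule sum.cong[OF refl])
    fix k assume "k \<in> {1..n}"
    then have "(\<Sum>j = 1..k. M k j * (y j \<bullet> y k)) = (\<Sum>j = 1..k. \<Sum>l = k..n. D l j * (y j \<bullet> y k))"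
      by (simp add: M sum_distrib_right)
    then show "(\<Sum>j = 1..k. M k j * (y j \<bullet> y k)) = (\<Sum>l = k..n. \<Sum>j = 1..k. D l j * (y j \<bullet> y k))"
      by (subst sum.swap)
  qed
  also have "\<dots> = (\<Sum>l = 1..n. \<Sum>k = 1..l. \<Sum>j = 1..k. D l j * (y j \<bullet> y k))"
    by (rule sum_triangle_swap)
  also have "\<dots> = (\<Sum>l = 1..n. \<Sum>j = 1..l. D l j * (y j \<bullet> (\<Sum>k = j..l. y k)))"
  proof (rule sum.cong[OF refl])
    fix l
    have "(\<Sum>k = 1..l. \<Sum>j = 1..k. D l j * (y j \<bullet> y k)) = (\<Sum>j = 1..l. \<Sum>k = j..l. D l j * (y j \<bullet> y k))"
      by (rule sum_triangle_swap[symmetric])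
    then show "(\<Sum>k = 1..l. \<Sum>j = 1..k. D l j * (y j \<bullet> y k)) = (\<Sum>j = 1..l. D l j * (y j \<bullet> (\<Sum>k = j..l. y k)))"
      by (simp add: inner_sum_right sum_distrib_left)
  qed
  also have "0 \<le> \<dots>"
    by (intro sum_nonneg weighted_tail_sums_nonneg) (auto simp: D_def decr mixed)
  finally show ?thesis .
qed

text \<open>The ratios of consecutive terms of a log-convex sequence increase.\<close>

lemma log_convex_ratio_mono:
  fixes c :: "nat \<Rightarrow> real"
  assumes pos: "\<And>j. 0 < c j" and lc: "\<And>j. (c (Suc j))\<^sup>2 \<le> c j * c (Suc (Suc j))"
    and "p \<le> q"
  shows "c (Suc p) * c q \<le> c (Suc q) * c p"
  using \<open>p \<le> q\<close>
proof (induction q rule: dec_induct)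
  case (step q)
  have "c (Suc p) / c p \<le> c (Suc q) / c q"
    using step.IH pos by (simp add: frac_le_eq divide_simps mult.commute)
  also have "\<dots> \<le> c (Suc (Suc q)) / c (Suc q)"
    using lc[of q] pos by (simp add: divide_simps power2_eq_square mult.commute)
  finally show ?case using pos[of p] pos[of "Suc q"] by (simp add: divide_simps mult.commute)
qed simp

text \<open>The kernel \<open>c (n - k) c (k - j)\<close> first decreases and then increases in \<open>k\<close>, so the
  monotonicity criterion above fails for it. Rescaling to \<open>y k = c (n - k) x k\<close> turns it into
  \<open>c (k - j) / c (n - j)\<close>, which decreases in \<open>k\<close>. For this kernel the mixed monotonicity in
  \<open>k\<close> and \<open>j\<close> is again a consequence of log-convexity.\<close>

lemma log_convex_convolution_form_nonneg:
  fixes c :: "nat \<Rightarrow> real" and x :: "nat \<Rightarrow> 'v::real_inner"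
  assumes pos: "\<And>j. 0 < c j" and decr: "\<And>j. c (Suc j) \<le> c j"
    and lc: "\<And>j. (c (Suc j))\<^sup>2 \<le> c j * c (Suc (Suc j))"
  shows "0 \<le> (\<Sum>k = 1..n. c (n - k) * ((\<Sum>j = 1..k. c (k - j) *\<^sub>R x j) \<bullet> x k))"
proof -
  \<comment> \<open>The row after the last one is zero, so the last difference is the last row, which is constant.\<close>
  define M where "M k j = (if k \<le> n then c (k - j) / c (n - j) else 0)" for k j
  define y where "y k = c (n - k) *\<^sub>R x k" for k
  have nz: "c j \<noteq> 0" for j using pos[of j] by simp
  have "0 \<le> (\<Sum>k = 1..n. \<Sum>j = 1..k. M k j * (y j \<bullet> y k))"
  proof (rule triangular_form_nonneg)
    show "M (Suc n) j = 0" for j by (simp add: M_def)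
    show "M (Suc l) j \<le> M l j" if "1 \<le> j" "j \<le> l" "l \<le> n" for l j
      using that pos decr[of "l - j"] by (auto simp: M_def Suc_diff_le divide_right_mono less_imp_le)
    show "M l j - M (Suc l) j \<le> M l (Suc j) - M (Suc l) (Suc j)" if "1 \<le> j" "j < l" "l \<le> n" for l j
    proof (cases "l = n")
      case True
      then show ?thesis using that nz by (simp add: M_def)
    next
      case False
      obtain m where m: "l = Suc (j + m)" using \<open>j < l\<close> less_iff_Suc_add by auto
      obtain r where "n = Suc (l + r)" using False \<open>l \<le> n\<close> less_iff_Suc_add[of l n] by auto
      then obtain q where q: "n = Suc (j + q)" "m < q" using m by (intro that[of "Suc (m + r)"]) auto
      \<comment> \<open>With the ratio inequality multiplied by \<open>c (Suc m)\<close>, the claim reduces to log-convexity at \<open>m\<close>.\<close>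
      have r: "c (Suc (Suc m)) * c q \<le> c (Suc q) * c (Suc m)"
        using log_convex_ratio_mono[of c "Suc m" q, OF pos lc] \<open>m < q\<close> by simp
      have "(c (Suc m) - c (Suc (Suc m))) * c q * c (Suc m)
          = ((c (Suc m))\<^sup>2 - c (Suc m) * c (Suc (Suc m))) * c q"
        by (simp add: power2_eq_square algebra_simps)
      also have "\<dots> \<le> (c m * c (Suc (Suc m)) - c (Suc m) * c (Suc (Suc m))) * c q"
        using lc[of m] pos[of q] by (intro mult_right_mono) auto
      also have "\<dots> = (c m - c (Suc m)) * (c (Suc (Suc m)) * c q)" by (simp add: algebra_simps)
      also have "\<dots> \<le> (c m - c (Suc m)) * (c (Suc q) * c (Suc m))"
        using r decr[of m] by (intro mult_left_mono) auto
      finally have "(c (Suc m) - c (Suc (Suc m))) * c q \<le> (c m - c (Suc m)) * c (Suc q)"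
        using pos[of "Suc m"] by (simp add: mult.assoc[symmetric])
      then have "(c (Suc m) - c (Suc (Suc m))) / c (Suc q) \<le> (c m - c (Suc m)) / c q"
        using pos[of q] pos[of "Suc q"] by (simp add: divide_simps)
      then show ?thesis using m q by (simp add: M_def diff_divide_distrib Suc_diff_le)
    qed
  qed
  also have "(\<Sum>k = 1..n. \<Sum>j = 1..k. M k j * (y j \<bullet> y k))
      = (\<Sum>k = 1..n. c (n - k) * ((\<Sum>j = 1..k. c (k - j) *\<^sub>R x j) \<bullet> x k))"
    using nz by (auto intro!: sum.cong simp: M_def y_def inner_sum_left sum_distrib_left)
  finally show ?thesis .
qed

section \<open>The L1 weights and the discrete Caputo derivative\<close>

text \<open>The increments are integrals over a unit interval of multiples of \<open>x powr (\<beta> - 1)\<close>, so a sign that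
  a combination of shifts of this function has at every point carries over to the increments.
  The left endpoint \<open>p = 0\<close>, where the derivative is singular, has to be included; it is the first
  L1 weight.\<close>

lemma powr_increment_combination_nonneg:
  fixes \<beta> u v w :: real
  assumes \<beta>: "0 < \<beta>" "\<beta> < 1" and "0 \<le> p"
    and comb: "\<And>s. 0 < s \<Longrightarrow> 0 \<le> u * (p + 2 + s) powr (\<beta> - 1) + v * (p + 1 + s) powr (\<beta> - 1) + w * (p + s) powr (\<beta> - 1)"
  shows "0 \<le> u * ((p + 3) powr \<beta> - (p + 2) powr \<beta>) + v * ((p + 2) powr \<beta> - (p + 1) powr \<beta>)
      + w * ((p + 1) powr \<beta> - p powr \<beta>)"
proof -
  define Q where "Q s = u * (p + 2 + s) powr \<beta> + v * (p + 1 + s) powr \<beta> + w * (p + s) powr \<beta>" for s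
  have "Q 0 \<le> Q 1"
  proof (rule DERIV_nonneg_imp_increasing_open[of 0 1 Q])
    fix s :: real assume s: "0 < s" "s < 1"
    have "(Q has_real_derivative (u * (\<beta> * (p + 2 + s) powr (\<beta> - 1)) + v * (\<beta> * (p + 1 + s) powr (\<beta> - 1))
        + w * (\<beta> * (p + s) powr (\<beta> - 1)))) (at s)"
      unfolding Q_def using s \<open>0 \<le> p\<close> by (auto intro!: derivative_eq_intros simp: powr_diff algebra_simps)
    moreover have "0 \<le> \<beta> * (u * (p + 2 + s) powr (\<beta> - 1) + v * (p + 1 + s) powr (\<beta> - 1) + w * (p + s) powr (\<beta> - 1))"
      using comb[OF s(1)] \<beta> by simp
    ultimately show "\<exists>z. (Q has_real_derivative z) (at s) \<and> 0 \<le> z"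
      by (intro exI conjI) (assumption, simp add: algebra_simps)
  next
    show "continuous_on {0..1} Q"
      unfolding Q_def using \<beta> \<open>0 \<le> p\<close> by (intro continuous_intros continuous_on_powr') auto
  qed simp
  then show ?thesis by (simp add: Q_def algebra_simps)
qed

lemma L1_caputo_eq_sum: "L1_caputo \<alpha> dt v n = (\<Sum>j = 1..n. L1_coeff \<alpha> dt (n - j) * (v j - v (j - 1))) / dt"
  by (simp add: L1_caputo_def bdiff_def sum_divide_distrib)

lemma increment_convolution_eq_of_L1_caputo_eq:
  assumes dt: "0 < dt" and "L1_caputo \<alpha> dt v k = \<gamma> * r"
  shows "(\<Sum>j = 1..k. L1_coeff \<alpha> dt (k - j) * (v j - v (j - 1))) = \<gamma> * dt * r"
  using assms dt by (simp add: L1_caputo_eq_sum field_simps)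

context
  fixes \<alpha> dt :: real
  assumes \<alpha>: "0 < \<alpha>" "\<alpha> < 1" and dt: "0 < dt"
begin

lemma L1_coeff_pos: "0 < L1_coeff \<alpha> dt j"
  unfolding L1_coeff_def using \<alpha> dt
  by (intro mult_pos_pos divide_pos_pos Gamma_real_pos) (auto simp: powr_less_mono2)

lemma L1_coeff_decr: "L1_coeff \<alpha> dt (Suc j) \<le> L1_coeff \<alpha> dt j"
proof -
  have "0 \<le> 0 * ((real j + 3) powr (1 - \<alpha>) - (real j + 2) powr (1 - \<alpha>))
      + (-1) * ((real j + 2) powr (1 - \<alpha>) - (real j + 1) powr (1 - \<alpha>))
      + 1 * ((real j + 1) powr (1 - \<alpha>) - real j powr (1 - \<alpha>))"
    using \<alpha> by (intro powr_increment_combination_nonneg) (auto intro!: powr_mono2')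
  then show ?thesis
    unfolding L1_coeff_def using \<alpha> dt
    by (intro mult_left_mono) (auto simp: add_ac Gamma_real_pos less_imp_le)
qed

text \<open>A discriminant argument: the quadratic polynomial in \<open>r\<close> with coefficients given by three
  consecutive weights is nonnegative, since the corresponding polynomial built from values of the
  log-convex function \<open>x powr (-\<alpha>)\<close> is.\<close>

lemma L1_coeff_log_convex:
  "(L1_coeff \<alpha> dt (Suc j))\<^sup>2 \<le> L1_coeff \<alpha> dt j * L1_coeff \<alpha> dt (Suc (Suc j))"
proof -
  let ?c = "L1_coeff \<alpha> dt"
  define C where "C = dt powr (1 - \<alpha>) / Gamma (2 - \<alpha>)"
  have C: "0 < C" unfolding C_def using \<alpha> dt by (intro divide_pos_pos Gamma_real_pos) auto
  have nonneg: "0 \<le> r\<^sup>2 * ?c (Suc (Suc j)) + (- 2 * r) * ?c (Suc j) + 1 * ?c j" for r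
  proof -
    have "0 \<le> r\<^sup>2 * ((real j + 3) powr (1 - \<alpha>) - (real j + 2) powr (1 - \<alpha>))
        + (- 2 * r) * ((real j + 2) powr (1 - \<alpha>) - (real j + 1) powr (1 - \<alpha>))
        + 1 * ((real j + 1) powr (1 - \<alpha>) - real j powr (1 - \<alpha>))"
    proof (rule powr_increment_combination_nonneg)
      fix s :: real assume "0 < s"
      define X where "X = real j + 2 + s"
      define Y where "Y = real j + 1 + s"
      define Z where "Z = real j + s"
      have pos: "0 < X" "0 < Y" "0 < Z" using \<open>0 < s\<close> by (simp_all add: X_def Y_def Z_def)
      have le: "X * Z \<le> Y * Y" unfolding X_def Y_def Z_def by (simp add: algebra_simps)
      have e: "1 - \<alpha> - 1 = - \<alpha>" by simp
      have "Y powr (- \<alpha>) * Y powr (- \<alpha>) \<le> X powr (- \<alpha>) * Z powr (- \<alpha>)"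
        using powr_mono2'[of "- \<alpha>" "X * Z" "Y * Y"] \<alpha> pos le by (simp add: powr_mult)
      then have yy: "(Y powr (- \<alpha>))\<^sup>2 \<le> X powr (- \<alpha>) * Z powr (- \<alpha>)" by (simp add: power2_eq_square)
      have "0 \<le> (r * X powr (- \<alpha>) - Y powr (- \<alpha>))\<^sup>2 + (X powr (- \<alpha>) * Z powr (- \<alpha>) - (Y powr (- \<alpha>))\<^sup>2)"
        using yy by (intro add_nonneg_nonneg) auto
      also have "\<dots> = X powr (- \<alpha>) * (r\<^sup>2 * X powr (- \<alpha>) + (- 2 * r) * Y powr (- \<alpha>) + 1 * Z powr (- \<alpha>))"
        by (simp add: power2_eq_square algebra_simps)
      finally show "0 \<le> r\<^sup>2 * (real j + 2 + s) powr (1 - \<alpha> - 1) + (- 2 * r) * (real j + 1 + s) powr (1 - \<alpha> - 1)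
          + 1 * (real j + s) powr (1 - \<alpha> - 1)"
        using pos by (simp add: e zero_le_mult_iff flip: X_def Y_def Z_def)
    qed (use \<alpha> in auto)
    then have "0 \<le> C * (r\<^sup>2 * ((real j + 3) powr (1 - \<alpha>) - (real j + 2) powr (1 - \<alpha>))
        + (- 2 * r) * ((real j + 2) powr (1 - \<alpha>) - (real j + 1) powr (1 - \<alpha>))
        + 1 * ((real j + 1) powr (1 - \<alpha>) - real j powr (1 - \<alpha>)))"
      using C by simp
    then show ?thesis
      by (simp add: L1_coeff_def algebra_simps flip: C_def)
  qed
  have p: "0 < ?c (Suc (Suc j))" by (rule L1_coeff_pos)
  \<comment> \<open>the minimizer of the quadratic polynomial\<close>
  show ?thesis using nonneg[of "?c (Suc j) / ?c (Suc (Suc j))"] p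
    by (simp add: power2_eq_square field_simps)
qed

lemma L1_caputo_form_nonneg:
  fixes x :: "nat \<Rightarrow> 'v::real_inner"
  shows "0 \<le> (\<Sum>k = 1..n. L1_coeff \<alpha> dt (n - k) * ((\<Sum>j = 1..k. L1_coeff \<alpha> dt (k - j) *\<^sub>R x j) \<bullet> x k))"
  using L1_coeff_pos L1_coeff_decr L1_coeff_log_convex by (rule log_convex_convolution_form_nonneg)

lemma L1_caputo_nonpos_of_increment_bound:
  assumes "\<And>k. k \<in> {1..n} \<Longrightarrow> E k - E (k - 1) \<le> J k"
    and "(\<Sum>k = 1..n. L1_coeff \<alpha> dt (n - k) * J k) \<le> 0"
  shows "L1_caputo \<alpha> dt E n \<le> 0"
proof -
  have "(\<Sum>k = 1..n. L1_coeff \<alpha> dt (n - k) * (E k - E (k - 1))) \<le> (\<Sum>k = 1..n. L1_coeff \<alpha> dt (n - k) * J k)"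
    using assms(1) L1_coeff_pos by (intro sum_mono mult_left_mono) (auto intro: less_imp_le)
  then show ?thesis using assms(2) dt by (simp add: L1_caputo_eq_sum divide_nonpos_pos)
qed

text \<open>As the weights decrease, summation by parts gives every earlier value a nonpositive weight, so
  only the current value can make the discrete derivative positive.\<close>

lemma L1_caputo_le_of_nonneg_history:
  assumes "1 \<le> m" "\<And>j. j < m \<Longrightarrow> 0 \<le> u j"
  shows "L1_caputo \<alpha> dt u m \<le> L1_coeff \<alpha> dt 0 / dt * u m"
proof -
  let ?c = "L1_coeff \<alpha> dt"
  have "(\<Sum>j = 1..k. ?c (m - j) * (u j - u (j - 1))) \<le> ?c (m - k) * u k" if "k \<le> m" for k
    using that
  proof (induction k)
    case 0
    then show ?case using assms L1_coeff_pos[of m] by simp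
  next
    case (Suc k)
    have "?c (m - k) * u k \<le> ?c (m - Suc k) * u k"
      using L1_coeff_decr[of "m - Suc k"] Suc.prems assms(2)[of k]
      by (intro mult_right_mono) (auto simp: Suc_diff_Suc)
    then show ?case using Suc by (simp add: right_diff_distrib)
  qed
  from this[of m] show ?thesis using dt by (simp add: L1_caputo_eq_sum divide_right_mono)
qed

text \<open>The convolution form is nonnegative at every point of space, so its sign survives integration.
  In the applications \<open>z\<close> is the increment of the state or the gradient of a potential of that increment.\<close>

lemma weighted_integral_nonpos:
  fixes q :: "nat \<Rightarrow> 'a::euclidean_space \<Rightarrow> real" and z :: "nat \<Rightarrow> 'a \<Rightarrow> 'v::real_inner"
  assumes cont: "\<And>k. k \<in> {1..n} \<Longrightarrow> continuous_on UNIV (q k)" and \<kappa>: "0 < \<kappa>"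
    and q: "\<And>k x. k \<in> {1..n} \<Longrightarrow>
      \<kappa> * q k x = - ((\<Sum>j = 1..k. L1_coeff \<alpha> dt (k - j) *\<^sub>R z j x) \<bullet> z k x)"
  shows "(\<Sum>k = 1..n. L1_coeff \<alpha> dt (n - k) * integral (cbox a b) (q k)) \<le> 0"
proof -
  let ?c = "L1_coeff \<alpha> dt"
  have "(\<Sum>k = 1..n. ?c (n - k) * integral (cbox a b) (q k))
      = integral (cbox a b) (\<lambda>x. \<Sum>k = 1..n. ?c (n - k) * q k x)"
    using cont by (subst integral_sum) (auto intro!: continuous_integrable_cbox continuous_on_mult continuous_on_const)
  also have "\<dots> \<le> integral (cbox a b) (\<lambda>x. 0)"
  proof (intro integral_le continuous_integrable_cbox continuous_intros cont)
    fix x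
    have "\<kappa> * (\<Sum>k = 1..n. ?c (n - k) * q k x)
        = - (\<Sum>k = 1..n. ?c (n - k) * ((\<Sum>j = 1..k. ?c (k - j) *\<^sub>R z j x) \<bullet> z k x))"
      unfolding sum_distrib_left sum_negf[symmetric]
      by (intro sum.cong refl) (simp add: mult.left_commute[of \<kappa>] q)
    also have "\<dots> \<le> 0" using L1_caputo_form_nonneg by simp
    finally show "(\<Sum>k = 1..n. ?c (n - k) * q k x) \<le> 0"
      using \<kappa> by (simp add: mult_le_0_iff)
  qed auto
  finally show ?thesis by simp
qed

end

section \<open>One-step energy inequalities\<close>

text \<open>The Taylor remainder of the quartic is \<open>(g - f)\<^sup>2\<close> times the polynomial
  \<open>(g\<^sup>2 + 2 f g + 3 f\<^sup>2) / 4 - 1/2\<close>, which is at most \<open>1\<close> on the square \<open>[-1, 1]\<^sup>2\<close>.\<close>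

lemma double_well_descent:
  assumes "\<bar>f\<bar> \<le> 1" "\<bar>g\<bar> \<le> 1" "1 \<le> S"
  shows "double_well g \<le> double_well f + (f ^ 3 - f) * (g - f) + S * (g - f)\<^sup>2"
proof -
  have sq: "f\<^sup>2 \<le> 1" "g\<^sup>2 \<le> 1" using assms by (simp_all add: abs_square_le_1)
  have "0 \<le> (f - g)\<^sup>2" by simp
  then have "2 * (f * g) \<le> f\<^sup>2 + g\<^sup>2" by (simp add: power2_diff)
  then have "1/4 * (g\<^sup>2 + 2 * (f * g) + 3 * f\<^sup>2) - 1/2 \<le> S" using sq assms(3) by argo
  then have "(1/4 * (g\<^sup>2 + 2 * (f * g) + 3 * f\<^sup>2) - 1/2) * (g - f)\<^sup>2 \<le> S * (g - f)\<^sup>2"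
    by (intro mult_right_mono) auto
  moreover have "double_well g - double_well f - (f ^ 3 - f) * (g - f)
      = (1/4 * (g\<^sup>2 + 2 * (f * g) + 3 * f\<^sup>2) - 1/2) * (g - f)\<^sup>2"
    unfolding double_well_def by (simp add: field_simps power2_eq_square power3_eq_cube)
  ultimately show ?thesis by simp
qed

lemma bounded_second_derivative_descent:
  assumes F: "Ck 2 F" and L: "\<And>s. \<bar>deriv (deriv F) s\<bar> \<le> L" and "L / 2 \<le> S"
  shows "F g \<le> F f + deriv F f * (g - f) + S * (g - f)\<^sup>2"
proof -
  define d where "d = g - f"
  have "F (f + 1 * d) \<le> F (f + 0 * d) + deriv F (f + 0 * d) * d + L * d\<^sup>2 / 2"
  proof (rule taylor_second_order_bound)
    show "((\<lambda>t. F (f + t * d)) has_real_derivative deriv F (f + t * d) * d) (at t)" for t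
      by (rule DERIV_chain2[OF Ck_2_real_derivs(1)[OF F]]) (auto intro!: derivative_eq_intros)
    show "((\<lambda>t. deriv F (f + t * d) * d) has_real_derivative deriv (deriv F) (f + t * d) * d * d) (at t)" for t
      by (intro DERIV_cmult_right DERIV_chain2[OF Ck_2_real_derivs(2)[OF F]]) (auto intro!: derivative_eq_intros)
    show "deriv (deriv F) (f + t * d) * d * d \<le> L * d\<^sup>2" for t
      using L[of "f + t * d"] by (simp add: power2_eq_square mult.assoc mult_right_mono)
  qed
  moreover have "L / 2 * d\<^sup>2 \<le> S * d\<^sup>2" using \<open>L / 2 \<le> S\<close> by (intro mult_right_mono) auto
  ultimately show ?thesis by (simp add: d_def)
qed

lemma one_plus_norm_square_pos: "0 < 1 + (norm p)\<^sup>2"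
  by (simp add: add_pos_nonneg)

text \<open>The second derivative of \<open>- ln (1 + |p|\<^sup>2) / 2\<close> in the direction \<open>d\<close> is at most
  \<open>|d|\<^sup>2 (|p|\<^sup>2 - 1) / (1 + |p|\<^sup>2)\<^sup>2\<close>. The largest value of this factor is \<open>1/8\<close>, attained for
  \<open>|p|\<^sup>2 = 3\<close>, and half of it is the constant \<open>1/16\<close>.\<close>

lemma neg_half_log_descent:
  fixes p q :: "'v::real_inner"
  shows "- (1/2) * ln (1 + (norm q)\<^sup>2)
    \<le> - (1/2) * ln (1 + (norm p)\<^sup>2) - (q - p) \<bullet> (p /\<^sub>R (1 + (norm p)\<^sup>2)) + 1/16 * (norm (q - p))\<^sup>2"
proof -
  define d where "d = q - p"
  define r where "r t = 1 + (norm (p + t *\<^sub>R d))\<^sup>2" for t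
  define s where "s t = (p + t *\<^sub>R d) \<bullet> d" for t
  have rpos: "0 < r t" for t by (simp add: r_def one_plus_norm_square_pos)
  have r: "(r has_real_derivative 2 * s t) (at t)" for t
    unfolding r_def s_def power2_norm_eq_inner
    by (auto intro!: derivative_eq_intros simp: has_field_derivative_def inner_add_left inner_add_right inner_commute algebra_simps)
  have s: "(s has_real_derivative (norm d)\<^sup>2) (at t)" for t
    unfolding s_def power2_norm_eq_inner
    by (auto intro!: derivative_eq_intros simp: has_field_derivative_def algebra_simps)
  have cs: "(s t)\<^sup>2 \<le> (r t - 1) * (norm d)\<^sup>2" for t
    using Cauchy_Schwarz_ineq[of "p + t *\<^sub>R d" d] by (simp add: s_def r_def power2_norm_eq_inner)
  have "- (1/2) * ln (r 1) \<le> - (1/2) * ln (r 0) + - s 0 / r 0 + (norm d)\<^sup>2 / 8 / 2"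
  proof (rule taylor_second_order_bound)
    show "((\<lambda>t. - (1/2) * ln (r t)) has_real_derivative - s t / r t) (at t)" for t
      using rpos[of t] by (auto intro!: derivative_eq_intros r)
    show "((\<lambda>t. - s t / r t) has_real_derivative (- (norm d)\<^sup>2 * r t - (- s t) * (2 * s t)) / (r t * r t)) (at t)" for t
      using rpos[of t] by (auto intro!: derivative_eq_intros r s simp: diff_divide_distrib)
    fix t
    \<comment> \<open>The bound is \<open>8 (r - 2) \<le> r\<^sup>2\<close>, that is, \<open>(r - 4)\<^sup>2 \<ge> 0\<close>.\<close>
    have "8 * (- (norm d)\<^sup>2 * r t - (- s t) * (2 * s t)) = 16 * (s t)\<^sup>2 - 8 * ((norm d)\<^sup>2 * r t)"
      by (simp add: power2_eq_square)
    also have "\<dots> \<le> 16 * ((r t - 1) * (norm d)\<^sup>2) - 8 * ((norm d)\<^sup>2 * r t)"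
      using cs[of t] by simp
    also have "\<dots> = (norm d)\<^sup>2 * (r t * r t) - (norm d)\<^sup>2 * (r t - 4)\<^sup>2"
      by (simp add: power2_eq_square algebra_simps)
    also have "\<dots> \<le> (norm d)\<^sup>2 * (r t * r t)" by simp
    finally show "(- (norm d)\<^sup>2 * r t - (- s t) * (2 * s t)) / (r t * r t) \<le> (norm d)\<^sup>2 / 8"
      using rpos[of t] by (simp add: divide_simps)
  qed
  moreover have "r 1 = 1 + (norm q)\<^sup>2" "r 0 = 1 + (norm p)\<^sup>2" by (simp_all add: r_def d_def)
  moreover have "- s 0 / r 0 = - ((q - p) \<bullet> (p /\<^sub>R r 0))"
    by (simp add: s_def d_def inner_commute divide_inverse mult.commute)
  ultimately show ?thesis by (simp add: d_def)
qed

text \<open>The negative gradient of \<open>- ln (1 + |p|\<^sup>2) / 2\<close> at \<open>p = grad f\<close>. Its divergence is the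
  variational derivative of the nonlinear energy without slope selection.\<close>

definition log_slope_flux :: "('a::euclidean_space \<Rightarrow> real) \<Rightarrow> 'a \<Rightarrow> 'a" where
  "log_slope_flux f x = grad f x /\<^sub>R (1 + (norm (grad f x))\<^sup>2)"

lemma log_slope_flux_Ck_1:
  assumes f: "Ck 2 f" and i: "i \<in> Basis"
  shows "Ck 1 (\<lambda>x. log_slope_flux f x \<bullet> i)"
proof -
  have p: "Ck 1 (partial j f)" if "j \<in> Basis" for j using f that by (simp add: Ck_2_iff del: Ck.simps One_nat_def)
  have "(norm (grad f x))\<^sup>2 = (\<Sum>j\<in>Basis. partial j f x * partial j f x)" for x
    unfolding power2_norm_eq_inner by (subst inner_grad) (simp add: grad_inner_Basis)
  then have "Ck 1 (\<lambda>x. 1 + (norm (grad f x))\<^sup>2)"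
    using p by (auto intro!: Ck_add Ck_const Ck_sum Ck_1_mult simp del: Ck.simps One_nat_def)
  then have "Ck 1 (\<lambda>x. inverse (1 + (norm (grad f x))\<^sup>2) * partial i f x)"
    using one_plus_norm_square_pos[of "grad f _", THEN less_imp_neq, symmetric]
    by (intro Ck_1_mult Ck_1_inverse p i) (auto simp del: Ck.simps One_nat_def)
  then show ?thesis by (simp add: log_slope_flux_def grad_inner_Basis i del: Ck.simps One_nat_def)
qed

lemma box_periodic_log_slope_flux:
  "box_periodic a b f \<Longrightarrow> Ck 2 f \<Longrightarrow> box_periodic a b (\<lambda>x. log_slope_flux f x \<bullet> i)"
  unfolding log_slope_flux_def
  by (subst box_periodic_def) (simp add: box_periodic_grad Ck_2_iff)

context
  fixes a b :: "'a::euclidean_space"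
  assumes ab: "\<forall>i\<in>Basis. a \<bullet> i < b \<bullet> i"
begin

text \<open>Integration by parts rewrites all terms with the Laplacian in terms of gradients. After that the
  inequality holds pointwise: the Dirichlet energy is convex and treated implicitly, and the
  potential satisfies the descent inequality, in which \<open>S\<close> pays for its explicit treatment.\<close>

lemma second_order_energy_descent:
  assumes f: "box_periodic a b f" "Ck 2 f" and g: "box_periodic a b g" "Ck 2 g"
    and W: "continuous_on UNIV W" "continuous_on UNIV W'"
    and descent: "\<And>x. W (g x) \<le> W (f x) + W' (f x) * (g x - f x) + S * (g x - f x)\<^sup>2"
  shows "(1/2 * L2_inner (cbox a b) g (\<lambda>x. - \<epsilon>\<^sup>2 * laplacian g x) + integral (cbox a b) (\<lambda>x. W (g x)))
      - (1/2 * L2_inner (cbox a b) f (\<lambda>x. - \<epsilon>\<^sup>2 * laplacian f x) + integral (cbox a b) (\<lambda>x. W (f x)))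
    \<le> integral (cbox a b) (\<lambda>x. (- \<epsilon>\<^sup>2 * laplacian g x + W' (f x) + S * (g x - f x)) * (g x - f x))"
proof -
  let ?I = "integral (cbox a b)"
  note f1 = Ck_2_imp_Ck_1[OF f(2)] and g1 = Ck_2_imp_Ck_1[OF g(2)]
  note d1 = Ck_diff[OF g1 f1]
  have c: "continuous_on UNIV f" "continuous_on UNIV g" "continuous_on UNIV (\<lambda>x. W (f x))"
    "continuous_on UNIV (\<lambda>x. W (g x))" "continuous_on UNIV (\<lambda>x. W' (f x))"
    "continuous_on UNIV (grad f)" "continuous_on UNIV (grad g)" "continuous_on UNIV (laplacian g)"
    "continuous_on UNIV (grad (\<lambda>x. g x - f x))"
    using f1 g1 d1 g(2) W by (auto intro!: Ck_1_continuous[OF f1] Ck_1_continuous[OF g1]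
        grad_continuous[OF f1] grad_continuous[OF g1] grad_continuous[OF d1] laplacian_continuous
        intro: continuous_on_compose2[of UNIV] simp del: Ck.simps One_nat_def)
  have sq: "L2_inner (cbox a b) u (\<lambda>x. - \<epsilon>\<^sup>2 * laplacian u x) = \<epsilon>\<^sup>2 * ?I (\<lambda>x. grad u x \<bullet> grad u x)"
    if "box_periodic a b u" "Ck 2 u" for u
  proof -
    have "L2_inner (cbox a b) u (\<lambda>x. - \<epsilon>\<^sup>2 * laplacian u x) = ?I (\<lambda>x. - \<epsilon>\<^sup>2 * (u x * laplacian u x))"
      unfolding L2_inner_def by (intro arg_cong[where f = ?I] ext) simp
    also have "\<dots> = - \<epsilon>\<^sup>2 * ?I (\<lambda>x. u x * laplacian u x)" by (rule integral_mult_right)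
    finally show ?thesis
      using integral_mult_laplacian[OF ab that(1) Ck_2_imp_Ck_1[OF that(2)] that] by simp
  qed
  have cross: "?I (\<lambda>x. (g x - f x) * laplacian g x) = - ?I (\<lambda>x. grad (\<lambda>x. g x - f x) x \<bullet> grad g x)"
    by (rule integral_mult_laplacian[OF ab box_periodic_diff[OF g(1) f(1)] d1 g])
  note hi = integrable_integral[OF continuous_integrable_cbox]
  have "?I (\<lambda>x. (- \<epsilon>\<^sup>2 * laplacian g x + W' (f x) + S * (g x - f x)) * (g x - f x))
      = ?I (\<lambda>x. - \<epsilon>\<^sup>2 * ((g x - f x) * laplacian g x) + (W' (f x) + S * (g x - f x)) * (g x - f x))"
    by (intro arg_cong[where f = ?I] ext) (simp add: algebra_simps)
  also have "\<dots> = - \<epsilon>\<^sup>2 * ?I (\<lambda>x. (g x - f x) * laplacian g x)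
      + ?I (\<lambda>x. (W' (f x) + S * (g x - f x)) * (g x - f x))"
    by (intro integral_unique has_integral_add has_integral_mult_right hi continuous_intros c)
  finally have rhs: "?I (\<lambda>x. (- \<epsilon>\<^sup>2 * laplacian g x + W' (f x) + S * (g x - f x)) * (g x - f x))
      = \<epsilon>\<^sup>2 * ?I (\<lambda>x. grad (\<lambda>x. g x - f x) x \<bullet> grad g x)
        + ?I (\<lambda>x. (W' (f x) + S * (g x - f x)) * (g x - f x))"
    by (simp add: cross)
  have "1/2 * \<epsilon>\<^sup>2 * ?I (\<lambda>x. grad g x \<bullet> grad g x) + ?I (\<lambda>x. W (g x))
      \<le> 1/2 * \<epsilon>\<^sup>2 * ?I (\<lambda>x. grad f x \<bullet> grad f x) + ?I (\<lambda>x. W (f x))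
        + (\<epsilon>\<^sup>2 * ?I (\<lambda>x. grad (\<lambda>x. g x - f x) x \<bullet> grad g x)
        + ?I (\<lambda>x. (W' (f x) + S * (g x - f x)) * (g x - f x)))"
  proof (rule has_integral_le)
    show "((\<lambda>x. 1/2 * \<epsilon>\<^sup>2 * (grad g x \<bullet> grad g x) + W (g x)) has_integral
        1/2 * \<epsilon>\<^sup>2 * ?I (\<lambda>x. grad g x \<bullet> grad g x) + ?I (\<lambda>x. W (g x))) (cbox a b)"
      by (intro has_integral_add has_integral_mult_right hi continuous_intros c)
    show "((\<lambda>x. 1/2 * \<epsilon>\<^sup>2 * (grad f x \<bullet> grad f x) + W (f x)
          + (\<epsilon>\<^sup>2 * (grad (\<lambda>x. g x - f x) x \<bullet> grad g x) + (W' (f x) + S * (g x - f x)) * (g x - f x))) has_integral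
        1/2 * \<epsilon>\<^sup>2 * ?I (\<lambda>x. grad f x \<bullet> grad f x) + ?I (\<lambda>x. W (f x))
        + (\<epsilon>\<^sup>2 * ?I (\<lambda>x. grad (\<lambda>x. g x - f x) x \<bullet> grad g x)
        + ?I (\<lambda>x. (W' (f x) + S * (g x - f x)) * (g x - f x)))) (cbox a b)"
      by (intro has_integral_add has_integral_mult_right hi continuous_intros c)
    fix x
    have "0 \<le> (grad g x - grad f x) \<bullet> (grad g x - grad f x)" by simp
    then have "1/2 * (grad g x \<bullet> grad g x) \<le> 1/2 * (grad f x \<bullet> grad f x) + (grad g x - grad f x) \<bullet> grad g x"
      by (simp add: inner_diff_left inner_diff_right inner_commute)
    then have "\<epsilon>\<^sup>2 * (1/2 * (grad g x \<bullet> grad g x)) \<le> \<epsilon>\<^sup>2 * (1/2 * (grad f x \<bullet> grad f x) + (grad g x - grad f x) \<bullet> grad g x)"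
      by (intro mult_left_mono) auto
    then have "1/2 * \<epsilon>\<^sup>2 * (grad g x \<bullet> grad g x)
        \<le> 1/2 * \<epsilon>\<^sup>2 * (grad f x \<bullet> grad f x) + \<epsilon>\<^sup>2 * ((grad g x - grad f x) \<bullet> grad g x)"
      by (simp only: distrib_left mult.assoc mult.left_commute)
    moreover have "grad (\<lambda>x. g x - f x) x = grad g x - grad f x"
      using f1 g1 by (intro grad_diff) simp_all
    moreover have "(W' (f x) + S * (g x - f x)) * (g x - f x) = W' (f x) * (g x - f x) + S * (g x - f x)\<^sup>2"
      by (simp add: power2_eq_square algebra_simps)
    ultimately show "1/2 * \<epsilon>\<^sup>2 * (grad g x \<bullet> grad g x) + W (g x)
        \<le> 1/2 * \<epsilon>\<^sup>2 * (grad f x \<bullet> grad f x) + W (f x)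
          + (\<epsilon>\<^sup>2 * (grad (\<lambda>x. g x - f x) x \<bullet> grad g x) + (W' (f x) + S * (g x - f x)) * (g x - f x))"
      using descent[of x] by simp
  qed
  then show ?thesis unfolding sq[OF f] sq[OF g] rhs by linarith
qed

text \<open>The same mechanism one order higher: integration by parts leaves Laplacians in the convex part and
  gradients in the logarithmic part, where the stabilization contributes
  \<open>S |grad (g - f)|\<^sup>2\<close>.\<close>

lemma fourth_order_energy_descent:
  assumes f: "box_periodic a b f" "Ck 2 f" "Ck 2 (laplacian f)"
    and g: "box_periodic a b g" "Ck 2 g" "Ck 2 (laplacian g)" and S: "1/16 \<le> S"
  shows "(1/2 * L2_inner (cbox a b) g (\<lambda>x. \<epsilon>\<^sup>2 * laplacian (laplacian g) x)
        + - (1/2) * integral (cbox a b) (\<lambda>x. ln (1 + (norm (grad g x))\<^sup>2)))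
      - (1/2 * L2_inner (cbox a b) f (\<lambda>x. \<epsilon>\<^sup>2 * laplacian (laplacian f) x)
        + - (1/2) * integral (cbox a b) (\<lambda>x. ln (1 + (norm (grad f x))\<^sup>2)))
    \<le> integral (cbox a b) (\<lambda>x. (\<epsilon>\<^sup>2 * laplacian (laplacian g) x + divergence (log_slope_flux f) x
        + - S * laplacian (\<lambda>y. g y - f y) x) * (g x - f x))"
proof -
  let ?I = "integral (cbox a b)"
  define d where "d = (\<lambda>x. g x - f x)"
  define V where "V = log_slope_flux f"
  note f1 = Ck_2_imp_Ck_1[OF f(2)] and g1 = Ck_2_imp_Ck_1[OF g(2)]
  have d2: "Ck 2 d" unfolding d_def by (rule Ck_diff[OF g(2) f(2)])
  note d1 = Ck_2_imp_Ck_1[OF d2]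
  have dp: "box_periodic a b d" unfolding d_def by (rule box_periodic_diff[OF g(1) f(1)])
  have V: "Ck 1 (\<lambda>x. V x \<bullet> i)" "box_periodic a b (\<lambda>x. V x \<bullet> i)" if "i \<in> Basis" for i
    unfolding V_def using that f by (auto intro: log_slope_flux_Ck_1 box_periodic_log_slope_flux simp del: Ck.simps One_nat_def)
  have n0: "1 + (norm p)\<^sup>2 \<noteq> 0" for p :: 'a using one_plus_norm_square_pos[of p] by simp
  have cl: "continuous_on UNIV (\<lambda>x. ln (1 + (norm (grad u x))\<^sup>2))" if "Ck 1 u" for u :: "'a \<Rightarrow> real"
    using that by (intro continuous_intros grad_continuous) (auto simp: n0)
  have cV: "continuous_on UNIV V"
    unfolding V_def log_slope_flux_def by (intro continuous_intros grad_continuous f1) (auto simp: n0)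
  have c: "continuous_on UNIV d" "continuous_on UNIV (laplacian f)" "continuous_on UNIV (laplacian g)"
    "continuous_on UNIV (laplacian d)" "continuous_on UNIV (laplacian (laplacian g))"
    "continuous_on UNIV (grad d)" "continuous_on UNIV (divergence V)"
    by (intro Ck_1_continuous[OF d1] laplacian_continuous[OF f(2)] laplacian_continuous[OF g(2)]
        laplacian_continuous[OF g(3)] laplacian_continuous[OF d2] grad_continuous[OF d1]
        continuous_divergence V(1); assumption)+
  note c = c cV cl[OF f1] cl[OF g1]
  note hi = integrable_integral[OF continuous_integrable_cbox]
  have sq: "L2_inner (cbox a b) u (\<lambda>x. \<epsilon>\<^sup>2 * laplacian (laplacian u) x) = \<epsilon>\<^sup>2 * ?I (\<lambda>x. laplacian u x * laplacian u x)"
    if u: "box_periodic a b u" "Ck 2 u" "Ck 2 (laplacian u)" for u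
  proof -
    have "L2_inner (cbox a b) u (\<lambda>x. \<epsilon>\<^sup>2 * laplacian (laplacian u) x) = \<epsilon>\<^sup>2 * ?I (\<lambda>x. u x * laplacian (laplacian u) x)"
      unfolding L2_inner_def integral_mult_right[symmetric]
      by (intro arg_cong[where f = ?I] ext) simp
    then show ?thesis
      using integral_laplacian_symmetric[OF ab u(1,2) box_periodic_laplacian[OF u(1,2)] u(3)] by simp
  qed
  have cross: "?I (\<lambda>x. d x * laplacian (laplacian g) x) = ?I (\<lambda>x. laplacian g x * laplacian d x)"
    by (rule integral_laplacian_symmetric[OF ab dp d2 box_periodic_laplacian[OF g(1,2)] g(3)])
  have flux: "?I (\<lambda>x. d x * divergence V x) = - ?I (\<lambda>x. grad d x \<bullet> V x)"
    using V by (intro integral_mult_divergence[OF ab dp d1])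
  have stab: "?I (\<lambda>x. d x * laplacian d x) = - ?I (\<lambda>x. grad d x \<bullet> grad d x)"
    by (rule integral_mult_laplacian[OF ab dp d1 dp d2])
  have "?I (\<lambda>x. (\<epsilon>\<^sup>2 * laplacian (laplacian g) x + divergence V x + - S * laplacian d x) * d x)
      = ?I (\<lambda>x. \<epsilon>\<^sup>2 * (d x * laplacian (laplacian g) x) + d x * divergence V x + - S * (d x * laplacian d x))"
    by (intro arg_cong[where f = ?I] ext) (simp add: algebra_simps)
  also have "\<dots> = \<epsilon>\<^sup>2 * ?I (\<lambda>x. d x * laplacian (laplacian g) x) + ?I (\<lambda>x. d x * divergence V x)
      + - S * ?I (\<lambda>x. d x * laplacian d x)"
    by (intro integral_unique has_integral_add has_integral_mult_right hi continuous_intros c)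
  finally have rhs: "?I (\<lambda>x. (\<epsilon>\<^sup>2 * laplacian (laplacian g) x + divergence V x + - S * laplacian d x) * d x)
      = \<epsilon>\<^sup>2 * ?I (\<lambda>x. laplacian g x * laplacian d x) - ?I (\<lambda>x. grad d x \<bullet> V x)
        + S * ?I (\<lambda>x. grad d x \<bullet> grad d x)"
    by (simp add: cross flux stab)
  have "1/2 * \<epsilon>\<^sup>2 * ?I (\<lambda>x. laplacian g x * laplacian g x) + - (1/2) * ?I (\<lambda>x. ln (1 + (norm (grad g x))\<^sup>2))
      \<le> 1/2 * \<epsilon>\<^sup>2 * ?I (\<lambda>x. laplacian f x * laplacian f x) + - (1/2) * ?I (\<lambda>x. ln (1 + (norm (grad f x))\<^sup>2))
        + (\<epsilon>\<^sup>2 * ?I (\<lambda>x. laplacian g x * laplacian d x) - ?I (\<lambda>x. grad d x \<bullet> V x)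
          + S * ?I (\<lambda>x. grad d x \<bullet> grad d x))"
  proof (rule has_integral_le)
    show "((\<lambda>x. 1/2 * \<epsilon>\<^sup>2 * (laplacian g x * laplacian g x) + - (1/2) * ln (1 + (norm (grad g x))\<^sup>2)) has_integral
        1/2 * \<epsilon>\<^sup>2 * ?I (\<lambda>x. laplacian g x * laplacian g x) + - (1/2) * ?I (\<lambda>x. ln (1 + (norm (grad g x))\<^sup>2)))
        (cbox a b)"
      by (intro has_integral_add has_integral_mult_right hi continuous_on_mult c)
    show "((\<lambda>x. 1/2 * \<epsilon>\<^sup>2 * (laplacian f x * laplacian f x) + - (1/2) * ln (1 + (norm (grad f x))\<^sup>2)
        + (\<epsilon>\<^sup>2 * (laplacian g x * laplacian d x) - grad d x \<bullet> V x + S * (grad d x \<bullet> grad d x))) has_integral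
        1/2 * \<epsilon>\<^sup>2 * ?I (\<lambda>x. laplacian f x * laplacian f x) + - (1/2) * ?I (\<lambda>x. ln (1 + (norm (grad f x))\<^sup>2))
        + (\<epsilon>\<^sup>2 * ?I (\<lambda>x. laplacian g x * laplacian d x) - ?I (\<lambda>x. grad d x \<bullet> V x)
          + S * ?I (\<lambda>x. grad d x \<bullet> grad d x))) (cbox a b)"
      by (intro has_integral_add has_integral_diff has_integral_mult_right hi continuous_on_mult continuous_on_inner c)
    fix x
    have ld: "laplacian d x = laplacian g x - laplacian f x"
      unfolding d_def by (rule laplacian_diff[OF g(2) f(2)])
    have gd: "grad d x = grad g x - grad f x"
      unfolding d_def using f1 g1 by (intro grad_diff) simp_all
    have "0 \<le> \<epsilon>\<^sup>2 * (laplacian g x - laplacian f x)\<^sup>2" by simp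
    then have "1/2 * \<epsilon>\<^sup>2 * (laplacian g x * laplacian g x)
        \<le> 1/2 * \<epsilon>\<^sup>2 * (laplacian f x * laplacian f x) + \<epsilon>\<^sup>2 * (laplacian g x * laplacian d x)"
      unfolding ld by (simp add: power2_eq_square algebra_simps)
    moreover have "1/16 * (norm (grad d x))\<^sup>2 \<le> S * (grad d x \<bullet> grad d x)"
      unfolding power2_norm_eq_inner using S by (intro mult_right_mono) auto
    ultimately show "1/2 * \<epsilon>\<^sup>2 * (laplacian g x * laplacian g x) + - (1/2) * ln (1 + (norm (grad g x))\<^sup>2)
        \<le> 1/2 * \<epsilon>\<^sup>2 * (laplacian f x * laplacian f x) + - (1/2) * ln (1 + (norm (grad f x))\<^sup>2)
        + (\<epsilon>\<^sup>2 * (laplacian g x * laplacian d x) - grad d x \<bullet> V x + S * (grad d x \<bullet> grad d x))"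
      using neg_half_log_descent[of "grad g x" "grad f x", folded gd log_slope_flux_def V_def] by linarith
  qed
  then show ?thesis unfolding sq[OF f] sq[OF g] rhs[symmetric] unfolding d_def V_def by linarith
qed

end

section \<open>Energy decay for L1-discretized gradient flows\<close>

text \<open>The discrete convolution with \<open>c\<close> is inverted step by step: if the convolution of the \<open>d j\<close>
  consists of Laplacians, so do the \<open>d j\<close> themselves, and the potentials are again related by the
  convolution. This provides the inverse Laplacian of the increments of the state as a classical
  periodic function.\<close>

lemma triangular_laplacian_potentials:
  fixes c :: "nat \<Rightarrow> real" and d \<mu> :: "nat \<Rightarrow> 'a::euclidean_space \<Rightarrow> real"
  assumes c0: "c 0 \<noteq> 0"
    and \<mu>: "\<And>k. k \<in> {1..n} \<Longrightarrow> Ck 2 (\<mu> k)" "\<And>k. k \<in> {1..n} \<Longrightarrow> box_periodic a b (\<mu> k)"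
    and d: "\<And>k x. k \<in> {1..n} \<Longrightarrow> (\<Sum>j = 1..k. c (k - j) * d j x) = \<kappa> * laplacian (\<mu> k) x"
  shows "\<exists>\<psi>. \<forall>k\<in>{1..n}. Ck 2 (\<psi> k) \<and> box_periodic a b (\<psi> k) \<and> (\<forall>x. laplacian (\<psi> k) x = d k x) \<and>
      (\<forall>x. (\<Sum>j = 1..k. c (k - j) * \<psi> j x) = \<kappa> * \<mu> k x)"
  using \<mu> d
proof (induction n)
  case (Suc n)
  have "\<exists>\<psi>. \<forall>k\<in>{1..n}. Ck 2 (\<psi> k) \<and> box_periodic a b (\<psi> k) \<and> (\<forall>x. laplacian (\<psi> k) x = d k x) \<and>
      (\<forall>x. (\<Sum>j = 1..k. c (k - j) * \<psi> j x) = \<kappa> * \<mu> k x)"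
    by (rule Suc.IH) (simp_all add: Suc.prems del: sum.cl_ivl_Suc One_nat_def)
  then obtain \<psi> where \<psi>_all: "\<forall>k\<in>{1..n}. Ck 2 (\<psi> k) \<and> box_periodic a b (\<psi> k) \<and>
      (\<forall>x. laplacian (\<psi> k) x = d k x) \<and> (\<forall>x. (\<Sum>j = 1..k. c (k - j) * \<psi> j x) = \<kappa> * \<mu> k x)"
    by blast
  have \<psi>: "Ck 2 (\<psi> k)" "box_periodic a b (\<psi> k)" "laplacian (\<psi> k) x = d k x"
    "(\<Sum>j = 1..k. c (k - j) * \<psi> j x) = \<kappa> * \<mu> k x" if "k \<in> {1..n}" for k x
    using bspec[OF \<psi>_all that] by blast+
  define H where "H = (\<lambda>x. \<Sum>j = 1..n. c (Suc n - j) * \<psi> j x)"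
  \<comment> \<open>the solution of the convolution equation at level \<open>n + 1\<close> for its newest term\<close>
  define p where "p = (\<lambda>x. 1 / c 0 * (\<kappa> * \<mu> (Suc n) x - H x))"
  define \<psi>' where "\<psi>' = \<psi>(Suc n := p)"
  have \<mu>2: "Ck 2 (\<mu> (Suc n))" using Suc.prems by simp
  have H2: "Ck 2 H" unfolding H_def by (intro Ck_sum Ck_cmult \<psi>(1))
  have lH: "laplacian H x = (\<Sum>j = 1..n. c (Suc n - j) * d j x)" for x
    unfolding H_def using \<psi>(1,3) by (subst laplacian_sum) (auto simp: laplacian_cmult intro!: Ck_cmult)
  have p2: "Ck 2 p" unfolding p_def by (intro Ck_cmult Ck_diff H2 \<mu>2)
  have lp: "laplacian p x = d (Suc n) x" for x
  proof -
    have "laplacian p x = 1 / c 0 * (\<kappa> * laplacian (\<mu> (Suc n)) x - laplacian H x)"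
      unfolding p_def using H2 \<mu>2 by (simp only: laplacian_cmult laplacian_diff Ck_cmult Ck_diff)
    also have "\<kappa> * laplacian (\<mu> (Suc n)) x = laplacian H x + c 0 * d (Suc n) x"
      using Suc.prems(3)[of "Suc n" x] by (simp add: lH)
    finally show ?thesis using c0 by simp
  qed
  have pp: "box_periodic a b p"
    using Suc.prems(2)[of "Suc n"] \<psi>(2) unfolding p_def H_def box_periodic_def by simp
  have sp: "(\<Sum>j = 1..n. c (Suc n - j) * \<psi>' j x) + c 0 * p x = \<kappa> * \<mu> (Suc n) x" for x
    using c0 by (simp add: \<psi>'_def p_def H_def)
  have "Ck 2 (\<psi>' k) \<and> box_periodic a b (\<psi>' k) \<and> (\<forall>x. laplacian (\<psi>' k) x = d k x) \<and>
      (\<forall>x. (\<Sum>j = 1..k. c (k - j) * \<psi>' j x) = \<kappa> * \<mu> k x)" if k: "k \<in> {1..Suc n}" for k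
  proof (cases "k = Suc n")
    case True
    then show ?thesis using p2 pp lp sp by (simp add: \<psi>'_def)
  next
    case False
    then have k': "k \<in> {1..n}" using k by simp
    moreover have "(\<Sum>j = 1..k. c (k - j) * \<psi>' j x) = (\<Sum>j = 1..k. c (k - j) * \<psi> j x)" for x
      using k' by (intro sum.cong) (auto simp: \<psi>'_def)
    ultimately show ?thesis using \<psi>[OF k'] False by (simp add: \<psi>'_def)
  qed
  then show ?case by blast
qed simp

context
  fixes \<alpha> \<gamma> dt :: real
  assumes \<alpha>: "0 < \<alpha>" "\<alpha> < 1" and \<gamma>: "0 < \<gamma>" and dt: "0 < dt"
begin

text \<open>The scheme says that \<open>- \<mu> k\<close> is, up to a positive factor, the convolution of the increments of
  \<open>\<phi>\<close>. Hence the weighted sum of the products of \<open>\<mu> k\<close> with the increments is a negative multiple of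
  the convolution form.\<close>

lemma L2_gradient_flow_energy_decay:
  fixes a b :: "'a::euclidean_space" and \<phi> \<mu> :: "nat \<Rightarrow> 'a \<Rightarrow> real"
  assumes n: "n \<le> N"
    and cont: "\<And>k. k \<le> N \<Longrightarrow> continuous_on UNIV (\<phi> k)" "\<And>k. k < N \<Longrightarrow> continuous_on UNIV (\<mu> (Suc k))"
    and scheme: "\<And>k x. k < N \<Longrightarrow> L1_caputo \<alpha> dt (\<lambda>k. \<phi> k x) (Suc k) = \<gamma> * (- \<mu> (Suc k) x)"
    and descent: "\<And>k. k < N \<Longrightarrow> E (\<phi> (Suc k)) - E (\<phi> k)
      \<le> integral (cbox a b) (\<lambda>x. \<mu> (Suc k) x * (\<phi> (Suc k) x - \<phi> k x))"
  shows "L1_caputo \<alpha> dt (\<lambda>k. E (\<phi> k)) n \<le> 0"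
proof (rule L1_caputo_nonpos_of_increment_bound[OF \<alpha> dt])
  let ?q = "\<lambda>k x. \<mu> k x * (\<phi> k x - \<phi> (k - 1) x)"
  have pred: "\<exists>k'. k = Suc k' \<and> k' < N" if "k \<in> {1..n}" for k
    using that n by (intro exI[of _ "k - 1"]) auto
  show "E (\<phi> k) - E (\<phi> (k - 1)) \<le> integral (cbox a b) (?q k)" if "k \<in> {1..n}" for k
    using pred[OF that] descent by auto
  show "(\<Sum>k = 1..n. L1_coeff \<alpha> dt (n - k) * integral (cbox a b) (?q k)) \<le> 0"
  proof (rule weighted_integral_nonpos[OF \<alpha> dt])
    show "0 < \<gamma> * dt" using \<gamma> dt by simp
    show "continuous_on UNIV (?q k)" if "k \<in> {1..n}" for k
      using pred[OF that] by (auto intro!: continuous_intros cont)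
    show "\<gamma> * dt * ?q k x = - ((\<Sum>j = 1..k. L1_coeff \<alpha> dt (k - j) *\<^sub>R (\<phi> j x - \<phi> (j - 1) x)) \<bullet> (\<phi> k x - \<phi> (k - 1) x))"
      if k: "k \<in> {1..n}" for k x
    proof -
      obtain k' where k': "k = Suc k'" "k' < N" using pred[OF k] by blast
      have "(\<Sum>j = 1..k. L1_coeff \<alpha> dt (k - j) * (\<phi> j x - \<phi> (j - 1) x)) = \<gamma> * dt * (- \<mu> k x)"
        using scheme[OF k'(2)] k'(1) by (intro increment_convolution_eq_of_L1_caputo_eq dt) simp
      then show ?thesis by simp
    qed
  qed
qed

text \<open>The increments of \<open>\<phi>\<close> are Laplacians of potentials \<open>\<psi> k\<close>, and \<open>\<mu> k\<close> is, up to a positive factor,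
  the convolution of these potentials. One integration by parts replaces the product of \<open>\<mu> k\<close> with
  the increment by \<open>- grad (\<mu> k) \<bullet> grad (\<psi> k)\<close>, and the weighted sum becomes a negative multiple of
  the convolution form in the gradients.\<close>

lemma Hminus1_gradient_flow_energy_decay:
  fixes a b :: "'a::euclidean_space" and \<phi> \<mu> :: "nat \<Rightarrow> 'a \<Rightarrow> real"
  assumes ab: "\<forall>i\<in>Basis. a \<bullet> i < b \<bullet> i" and n: "n \<le> N"
    and \<mu>: "\<And>k. k < N \<Longrightarrow> Ck 2 (\<mu> (Suc k))" "\<And>k. k < N \<Longrightarrow> box_periodic a b (\<mu> (Suc k))"
    and scheme: "\<And>k x. k < N \<Longrightarrow> L1_caputo \<alpha> dt (\<lambda>k. \<phi> k x) (Suc k) = \<gamma> * laplacian (\<mu> (Suc k)) x"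
    and descent: "\<And>k. k < N \<Longrightarrow> E (\<phi> (Suc k)) - E (\<phi> k)
      \<le> integral (cbox a b) (\<lambda>x. \<mu> (Suc k) x * (\<phi> (Suc k) x - \<phi> k x))"
  shows "L1_caputo \<alpha> dt (\<lambda>k. E (\<phi> k)) n \<le> 0"
proof -
  let ?c = "L1_coeff \<alpha> dt"
  have pred: "\<exists>k'. k = Suc k' \<and> k' < N" if "k \<in> {1..n}" for k
    using that n by (intro exI[of _ "k - 1"]) auto
  have \<mu>': "Ck 2 (\<mu> k)" "box_periodic a b (\<mu> k)" if "k \<in> {1..n}" for k
    using pred[OF that] \<mu> by blast+
  have "\<exists>\<psi>. \<forall>k\<in>{1..n}. Ck 2 (\<psi> k) \<and> box_periodic a b (\<psi> k) \<and>
      (\<forall>x. laplacian (\<psi> k) x = \<phi> k x - \<phi> (k - 1) x) \<and> (\<forall>x. (\<Sum>j = 1..k. ?c (k - j) * \<psi> j x) = \<gamma> * dt * \<mu> k x)"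
  proof (rule triangular_laplacian_potentials)
    show "?c 0 \<noteq> 0" using L1_coeff_pos[OF \<alpha> dt, of 0] by simp
    show "(\<Sum>j = 1..k. ?c (k - j) * (\<phi> j x - \<phi> (j - 1) x)) = \<gamma> * dt * laplacian (\<mu> k) x" if "k \<in> {1..n}" for k x
      using pred[OF that] scheme by (intro increment_convolution_eq_of_L1_caputo_eq dt) auto
  qed (rule \<mu>'; assumption)+
  then obtain \<psi> where \<psi>_all: "\<forall>k\<in>{1..n}. Ck 2 (\<psi> k) \<and> box_periodic a b (\<psi> k) \<and>
      (\<forall>x. laplacian (\<psi> k) x = \<phi> k x - \<phi> (k - 1) x) \<and> (\<forall>x. (\<Sum>j = 1..k. ?c (k - j) * \<psi> j x) = \<gamma> * dt * \<mu> k x)"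
    by blast
  have \<psi>: "Ck 2 (\<psi> k)" "box_periodic a b (\<psi> k)" "laplacian (\<psi> k) x = \<phi> k x - \<phi> (k - 1) x"
    "(\<Sum>j = 1..k. ?c (k - j) * \<psi> j x) = \<gamma> * dt * \<mu> k x" if "k \<in> {1..n}" for k x
    using bspec[OF \<psi>_all that] by blast+
  show ?thesis
  proof (rule L1_caputo_nonpos_of_increment_bound[OF \<alpha> dt])
    let ?q = "\<lambda>k x. - (grad (\<mu> k) x \<bullet> grad (\<psi> k) x)"
    show "E (\<phi> k) - E (\<phi> (k - 1)) \<le> integral (cbox a b) (?q k)" if k: "k \<in> {1..n}" for k
    proof -
      have "E (\<phi> k) - E (\<phi> (k - 1)) \<le> integral (cbox a b) (\<lambda>x. \<mu> k x * laplacian (\<psi> k) x)"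
        using pred[OF k] descent by (auto simp: \<psi>(3)[OF k])
      then show ?thesis
        using integral_mult_laplacian[OF ab \<mu>'(2)[OF k] Ck_2_imp_Ck_1[OF \<mu>'(1)[OF k]] \<psi>(2,1)[OF k]] by simp
    qed
    show "(\<Sum>k = 1..n. ?c (n - k) * integral (cbox a b) (?q k)) \<le> 0"
    proof (rule weighted_integral_nonpos[OF \<alpha> dt])
      show "0 < \<gamma> * dt" using \<gamma> dt by simp
      show "continuous_on UNIV (?q k)" if "k \<in> {1..n}" for k
        by (intro continuous_intros grad_continuous Ck_2_imp_Ck_1 \<mu>'[OF that] \<psi>[OF that])
      show "\<gamma> * dt * ?q k x = - ((\<Sum>j = 1..k. ?c (k - j) *\<^sub>R grad (\<psi> j) x) \<bullet> grad (\<psi> k) x)"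
        if k: "k \<in> {1..n}" for k x
      proof -
        have d\<psi>: "\<psi> j differentiable (at x)" if "j \<in> {1..k}" for j
          using Ck_2_imp_Ck_1[OF \<psi>(1)[of j]] that k by simp
        have "(\<lambda>x. \<gamma> * dt * \<mu> k x) = (\<lambda>x. \<Sum>j = 1..k. ?c (k - j) * \<psi> j x)" using \<psi>(4)[OF k] by simp
        then have "(\<gamma> * dt) *\<^sub>R grad (\<mu> k) x = grad (\<lambda>x. \<Sum>j = 1..k. ?c (k - j) * \<psi> j x) x"
          using grad_cmult[of "\<mu> k" x "\<gamma> * dt"] Ck_2_imp_Ck_1[OF \<mu>'(1)[OF k]] by simp
        also have "\<dots> = (\<Sum>j = 1..k. ?c (k - j) *\<^sub>R grad (\<psi> j) x)"
          by (rule grad_sum_cmult) (use d\<psi> in auto)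
        finally show ?thesis by (metis inner_scaleR_left mult_minus_right)
      qed
    qed
  qed
qed

section \<open>Maximum principle for the Allen--Cahn scheme\<close>

text \<open>At a maximum point of the new state the Laplacian is nonpositive, and the history can only push
  the value towards the earlier ones, which lie below \<open>1\<close>. The explicit part
  \<open>S f + f - f\<^sup>3\<close> stays below \<open>S\<close> on \<open>[-1, 1]\<close>; this is where \<open>S \<ge> 2\<close> enters.\<close>

lemma allen_cahn_upper_bound:
  fixes a b :: "'a::euclidean_space" and v :: "nat \<Rightarrow> 'a \<Rightarrow> real"
  assumes ab: "\<forall>i\<in>Basis. a \<bullet> i < b \<bullet> i" and S: "2 \<le> S" and m: "1 \<le> m"
    and vm: "box_periodic a b (v m)" "Ck 2 (v m)"
    and hist: "\<And>j x. j < m \<Longrightarrow> \<bar>v j x\<bar> \<le> 1"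
    and eq: "\<And>x. L1_caputo \<alpha> dt (\<lambda>k. v k x) m = - (\<gamma> * (- \<epsilon>\<^sup>2 * laplacian (v m) x
        + ((v (m - 1) x) ^ 3 - v (m - 1) x) + S * (v m x - v (m - 1) x)))"
  shows "v m y \<le> 1"
proof -
  obtain x where max: "\<And>y. v m y \<le> v m x"
    using box_periodic_has_max[OF ab vm(1) Ck_1_continuous[OF Ck_2_imp_Ck_1[OF vm(2)]]] by blast
  define B where "B = L1_coeff \<alpha> dt 0 / dt"
  define f g where "f = v (m - 1) x" and "g = v m x"
  have B: "0 < B" using L1_coeff_pos[OF \<alpha> dt] dt by (simp add: B_def)
  have f: "\<bar>f\<bar> \<le> 1" unfolding f_def using hist m by simp
  \<comment> \<open>The history estimate is used for the distance to the bound, which has been nonnegative so far.\<close>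
  have "L1_caputo \<alpha> dt (\<lambda>k. 1 - v k x) m \<le> B * (1 - g)"
    unfolding B_def g_def using hist m by (intro L1_caputo_le_of_nonneg_history \<alpha> dt) (auto simp: abs_le_iff)
  moreover have "L1_caputo \<alpha> dt (\<lambda>k. 1 - v k x) m = - L1_caputo \<alpha> dt (\<lambda>k. v k x) m"
    by (simp add: L1_caputo_def bdiff_def minus_divide_left[symmetric] sum_negf[symmetric] right_diff_distrib' diff_divide_distrib)
  ultimately have "\<gamma> * (- \<epsilon>\<^sup>2 * laplacian (v m) x + (f ^ 3 - f) + S * (g - f)) \<le> B * (1 - g)"
    using eq[of x] by (simp add: f_def g_def)
  moreover have "\<gamma> * ((f ^ 3 - f) + S * (g - f)) \<le> \<gamma> * (- \<epsilon>\<^sup>2 * laplacian (v m) x + (f ^ 3 - f) + S * (g - f))"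
    using laplacian_nonpos_at_max[OF vm(2) max] \<gamma> by (intro mult_left_mono) (auto simp: mult_nonneg_nonpos)
  moreover have "\<gamma> * (S * (g - 1)) \<le> \<gamma> * ((f ^ 3 - f) + S * (g - f))"
  proof -
    have "f\<^sup>2 \<le> 1" using f by (simp add: abs_square_le_1)
    then have "0 \<le> (1 - f) * (S - f - f\<^sup>2)" using f S by (intro mult_nonneg_nonneg) auto
    also have "\<dots> = (f ^ 3 - f) + S * (g - f) - S * (g - 1)"
      by (simp add: power2_eq_square power3_eq_cube algebra_simps)
    finally show ?thesis using \<gamma> by (intro mult_left_mono) auto
  qed
  ultimately have "0 \<le> (B + \<gamma> * S) * (1 - g)" by (simp add: algebra_simps)
  moreover have "0 < B + \<gamma> * S" using B \<gamma> S by (intro add_pos_pos) auto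
  ultimately have "g \<le> 1" by (simp add: zero_le_mult_iff)
  then show ?thesis using max[of y] by (simp add: g_def)
qed

text \<open>The scheme is odd in the state, so the lower bound is the upper bound for \<open>- \<phi>\<close>.\<close>

lemma allen_cahn_bounded:
  fixes a b :: "'a::euclidean_space" and \<phi> :: "nat \<Rightarrow> 'a \<Rightarrow> real"
  assumes ab: "\<forall>i\<in>Basis. a \<bullet> i < b \<bullet> i" and S: "2 \<le> S"
    and \<phi>: "\<And>n. n \<le> N \<Longrightarrow> box_periodic a b (\<phi> n)" "\<And>n. n \<le> N \<Longrightarrow> Ck 2 (\<phi> n)"
    and init: "\<And>x. \<bar>\<phi> 0 x\<bar> \<le> 1"
    and scheme: "\<And>n x. n < N \<Longrightarrow> L1_caputo \<alpha> dt (\<lambda>k. \<phi> k x) (Suc n) = \<gamma> * - (- \<epsilon>\<^sup>2 * laplacian (\<phi> (Suc n)) x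
        + ((\<phi> n x) ^ 3 - \<phi> n x) + S * (\<phi> (Suc n) x - \<phi> n x))"
    and "n \<le> N"
  shows "\<bar>\<phi> n x\<bar> \<le> 1"
  using \<open>n \<le> N\<close>
proof (induction n arbitrary: x rule: less_induct)
  case (less n)
  show ?case
  proof (cases n)
    case 0
    then show ?thesis using init by simp
  next
    case (Suc k)
    have hist: "\<bar>\<phi> j y\<bar> \<le> 1" if "j < n" for j y using less that by simp
    have \<phi>n: "box_periodic a b (\<phi> n)" "Ck 2 (\<phi> n)" using \<phi> less.prems by blast+
    have "\<phi> n x \<le> 1"
    proof (rule allen_cahn_upper_bound[OF ab S, where v = \<phi> and m = n and \<epsilon> = \<epsilon>])
      show "L1_caputo \<alpha> dt (\<lambda>k. \<phi> k x) n = - (\<gamma> * (- \<epsilon>\<^sup>2 * laplacian (\<phi> n) x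
        + ((\<phi> (n - 1) x) ^ 3 - \<phi> (n - 1) x) + S * (\<phi> n x - \<phi> (n - 1) x)))" for x
        using scheme[of k x] Suc less.prems by (simp add: algebra_simps)
    qed (use Suc \<phi>n hist in auto)
    moreover have "- 1 * \<phi> n x \<le> 1"
    proof (rule allen_cahn_upper_bound[OF ab S, where v = "\<lambda>k x. - 1 * \<phi> k x" and m = n and \<epsilon> = \<epsilon>])
      show "box_periodic a b (\<lambda>x. - 1 * \<phi> n x)" using \<phi>n by (simp add: box_periodic_def)
      show "Ck 2 (\<lambda>x. - 1 * \<phi> n x)" by (rule Ck_cmult[OF \<phi>n(2)])
      have "L1_caputo \<alpha> dt (\<lambda>k. - 1 * \<phi> k x) n = - L1_caputo \<alpha> dt (\<lambda>k. \<phi> k x) n" for x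
        unfolding L1_caputo_eq_sum by (simp add: minus_divide_left sum_negf[symmetric] right_diff_distrib)
      then show "L1_caputo \<alpha> dt (\<lambda>k. - 1 * \<phi> k x) n = - (\<gamma> * (- \<epsilon>\<^sup>2 * laplacian (\<lambda>x. - 1 * \<phi> n x) x
        + ((- 1 * \<phi> (n - 1) x) ^ 3 - - 1 * \<phi> (n - 1) x) + S * (- 1 * \<phi> n x - - 1 * \<phi> (n - 1) x)))" for x
        using scheme[of k x] Suc less.prems
        unfolding laplacian_cmult[OF \<phi>n(2)] by (simp add: power3_eq_cube algebra_simps)
    qed (use Suc hist in auto)
    ultimately show ?thesis by simp
  qed
qed

end

section \<open>Energy dissipation of the stabilized L1 schemes\<close>

theorem theorem2p1:
  fixes a b :: "'a::euclidean_space"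
    and \<alpha> \<gamma> \<epsilon> T S L :: real
    and N :: nat
    and F :: "real \<Rightarrow> real"
    and m :: "'a phase_model"
    and \<phi> :: "nat \<Rightarrow> 'a \<Rightarrow> real"
  assumes "0 < \<alpha>" and "\<alpha> < 1"
    and "\<gamma> > 0" and "\<epsilon> > 0" and "T > 0" and "N \<ge> 1"
    and "\<forall>i\<in>Basis. a \<bullet> i < b \<bullet> i"
    and "(m = allen_cahn (cbox a b) \<epsilon> S \<and> S \<ge> 2 \<and> sup_norm (cbox a b) (\<phi> 0) \<le> 1) \<or>
         (m = cahn_hilliard (cbox a b) \<epsilon> F S \<and> L > 0 \<and> truncated_double_well L F \<and> S \<ge> L / 2) \<or>
         (m = mbe_no_slope_selection (cbox a b) \<epsilon> S \<and> S \<ge> 1 / 16)"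
    and "L1_scheme_solution a b m \<alpha> \<gamma> (T / real N) N \<phi>"
  shows "\<forall>n\<in>{1..N}. L1_caputo \<alpha> (T / real N) (\<lambda>k. energy (cbox a b) m (\<phi> k)) n \<le> 0"
proof
  fix n assume "n \<in> {1..N}"
  then have n: "n \<le> N" by simp
  define dt where "dt = T / real N"
  have dt: "0 < dt" using assms(5,6) by (simp add: dt_def)
  note \<alpha> = assms(1,2) and \<gamma> = assms(3) and ab = assms(7)
  define \<mu> where "\<mu> k = chem_potential m (\<phi> k) (\<phi> (k - 1))" for k
  have per: "box_periodic a b (\<phi> k)" and dom: "\<phi> k \<in> lin_dom m" if "k \<le> N" for k
    using assms(9) that by (auto simp: L1_scheme_solution_def)
  have mob: "\<mu> (Suc k) \<in> mob_dom m" if "k < N" for k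
    using assms(9) that by (simp add: L1_scheme_solution_def \<mu>_def)
  have scheme: "L1_caputo \<alpha> dt (\<lambda>k. \<phi> k x) (Suc k) = \<gamma> * mobility m (\<mu> (Suc k)) x" if "k < N" for k x
    using assms(9) that by (simp add: L1_scheme_solution_def \<mu>_def dt_def)
  consider (AC) "m = allen_cahn (cbox a b) \<epsilon> S" "S \<ge> 2" "sup_norm (cbox a b) (\<phi> 0) \<le> 1"
    | (CH) "m = cahn_hilliard (cbox a b) \<epsilon> F S" "truncated_double_well L F" "S \<ge> L / 2"
    | (MBE) "m = mbe_no_slope_selection (cbox a b) \<epsilon> S" "S \<ge> 1 / 16"
    using assms(8) by blast
  then have "L1_caputo \<alpha> dt (\<lambda>k. energy (cbox a b) m (\<phi> k)) n \<le> 0"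
  proof cases
    case AC
    have C2: "Ck 2 (\<phi> k)" if "k \<le> N" for k using dom[OF that] by (simp add: AC(1) allen_cahn_def)
    have \<mu>: "\<mu> (Suc k) = (\<lambda>x. - \<epsilon>\<^sup>2 * laplacian (\<phi> (Suc k)) x + ((\<phi> k x) ^ 3 - \<phi> k x) + S * (\<phi> (Suc k) x - \<phi> k x))" for k
      by (simp add: \<mu>_def chem_potential_def AC(1) allen_cahn_def fun_eq_iff)
    have cont: "continuous_on A (\<phi> k)" if "k \<le> N" for k A
      by (rule Ck_1_continuous[OF Ck_2_imp_Ck_1[OF C2[OF that]]])
    have init: "\<bar>\<phi> 0 x\<bar> \<le> 1" for x
    proof -
      obtain y where y: "y \<in> cbox a b" "\<phi> 0 y = \<phi> 0 x"
        using box_periodic_attained_in_box[OF ab per[of 0], of x] by auto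
      have "bdd_above ((\<lambda>x. \<bar>\<phi> 0 x\<bar>) ` cbox a b)"
        by (intro bounded_imp_bdd_above compact_imp_bounded compact_continuous_image continuous_intros cont) simp_all
      then have "\<bar>\<phi> 0 y\<bar> \<le> sup_norm (cbox a b) (\<phi> 0)"
        unfolding sup_norm_def by (rule cSUP_upper[OF y(1)])
      then show ?thesis using AC(3) y(2) by simp
    qed
    have sch: "L1_caputo \<alpha> dt (\<lambda>k. \<phi> k x) (Suc k) = \<gamma> * (- \<mu> (Suc k) x)" if "k < N" for k x
      using scheme[OF that] by (simp add: AC(1) allen_cahn_def)
    have bound: "\<bar>\<phi> k x\<bar> \<le> 1" if "k \<le> N" for k x
      by (rule allen_cahn_bounded[OF \<alpha> \<gamma> dt ab AC(2) per C2 init sch[unfolded \<mu>] that])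
    show ?thesis
    proof (rule L2_gradient_flow_energy_decay[OF \<alpha> \<gamma> dt n cont _ sch])
      fix k assume k: "k < N"
      show "continuous_on UNIV (\<mu> (Suc k))"
        unfolding \<mu> using k by (intro continuous_intros cont laplacian_continuous C2) auto
      show "energy (cbox a b) m (\<phi> (Suc k)) - energy (cbox a b) m (\<phi> k)
          \<le> integral (cbox a b) (\<lambda>x. \<mu> (Suc k) x * (\<phi> (Suc k) x - \<phi> k x))"
        unfolding \<mu> energy_def AC(1) allen_cahn_def phase_model.simps using k AC(2)
        by (intro second_order_energy_descent[where W' = "\<lambda>s. s ^ 3 - s"] ab per C2 double_well_descent bound)
          (auto simp: double_well_def intro!: continuous_intros)
    qed auto
  next
    case CH
    have C2: "Ck 2 (\<phi> k)" if "k \<le> N" for k using dom[OF that] by (simp add: CH(1) cahn_hilliard_def)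
    have \<mu>: "\<mu> (Suc k) = (\<lambda>x. - \<epsilon>\<^sup>2 * laplacian (\<phi> (Suc k)) x + deriv F (\<phi> k x) + S * (\<phi> (Suc k) x - \<phi> k x))" for k
      by (simp add: \<mu>_def chem_potential_def CH(1) cahn_hilliard_def fun_eq_iff)
    have F: "Ck 2 F" "\<And>s. \<bar>deriv (deriv F) s\<bar> \<le> L"
      using CH(2) by (simp_all add: truncated_double_well_def)
    have cF: "continuous_on UNIV F" "continuous_on UNIV (deriv F)"
      using Ck_2_real_derivs[OF F(1)] by (auto intro: DERIV_continuous_on has_field_derivative_at_within)
    show ?thesis
    proof (rule Hminus1_gradient_flow_energy_decay[OF \<alpha> \<gamma> dt ab n, where \<phi> = \<phi> and \<mu> = \<mu>])
      fix k assume k: "k < N"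
      show "Ck 2 (\<mu> (Suc k))" using mob[OF k] by (simp add: CH(1) cahn_hilliard_def)
      show "box_periodic a b (\<mu> (Suc k))"
        unfolding \<mu> using box_periodic_laplacian[OF per C2, of "Suc k"] per[of k] per[of "Suc k"] k
        by (simp add: box_periodic_def)
      show "L1_caputo \<alpha> dt (\<lambda>k. \<phi> k x) (Suc k) = \<gamma> * laplacian (\<mu> (Suc k)) x" for x
        using scheme[OF k] by (simp add: CH(1) cahn_hilliard_def)
      show "energy (cbox a b) m (\<phi> (Suc k)) - energy (cbox a b) m (\<phi> k)
          \<le> integral (cbox a b) (\<lambda>x. \<mu> (Suc k) x * (\<phi> (Suc k) x - \<phi> k x))"
        unfolding \<mu> energy_def CH(1) cahn_hilliard_def phase_model.simps using k
        by (intro second_order_energy_descent ab per C2 bounded_second_derivative_descent[OF F CH(3)] cF) auto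
    qed
  next
    case MBE
    have C2: "Ck 2 (\<phi> k)" "Ck 2 (laplacian (\<phi> k))" if "k \<le> N" for k
      using dom[OF that] by (simp_all add: MBE(1) mbe_no_slope_selection_def)
    have \<mu>: "\<mu> (Suc k) = (\<lambda>x. \<epsilon>\<^sup>2 * laplacian (laplacian (\<phi> (Suc k))) x + divergence (log_slope_flux (\<phi> k)) x
        + - S * laplacian (\<lambda>y. \<phi> (Suc k) y - \<phi> k y) x)" for k
      by (simp add: \<mu>_def chem_potential_def MBE(1) mbe_no_slope_selection_def fun_eq_iff log_slope_flux_def[abs_def])
    show ?thesis
    proof (rule L2_gradient_flow_energy_decay[OF \<alpha> \<gamma> dt n, where \<phi> = \<phi> and \<mu> = \<mu>])
      show "continuous_on UNIV (\<phi> k)" if "k \<le> N" for k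
        by (rule Ck_1_continuous[OF Ck_2_imp_Ck_1[OF C2(1)[OF that]]])
      fix k assume k: "k < N"
      show "continuous_on UNIV (\<mu> (Suc k))"
        unfolding \<mu> using k
        by (intro continuous_intros laplacian_continuous continuous_divergence log_slope_flux_Ck_1 C2 Ck_diff) auto
      show "L1_caputo \<alpha> dt (\<lambda>k. \<phi> k x) (Suc k) = \<gamma> * (- \<mu> (Suc k) x)" for x
        using scheme[OF k] by (simp add: MBE(1) mbe_no_slope_selection_def)
      show "energy (cbox a b) m (\<phi> (Suc k)) - energy (cbox a b) m (\<phi> k)
          \<le> integral (cbox a b) (\<lambda>x. \<mu> (Suc k) x * (\<phi> (Suc k) x - \<phi> k x))"
        unfolding \<mu> energy_def MBE(1) mbe_no_slope_selection_def phase_model.simps using k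
        by (intro fourth_order_energy_descent ab per C2 MBE(2)) auto
    qed
  qed
  then show "L1_caputo \<alpha> (T / real N) (\<lambda>k. energy (cbox a b) m (\<phi> k)) n \<le> 0" by (simp add: dt_def)
qed

end
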